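(* Let $f\in B\mathcal S_{\mathbf M}$ have a Fourier series of the form $(F)$ (see context). Then for every $\tau>0$, every $n\in\mathbb N$ and every $\varphi\in\Phi$, $$E_{\lambda_n}(f)_{\mathbf M}\le K_{n,\varphi}(\tau)\,\omega_\varphi\Big(f,\frac{\tau}{\lambda_n}\Big)_{\mathbf M},$$ where $$K_{n,\varphi}(\tau):=\inf_{v\in V(\tau)}\frac{v(\tau)-v(0)}{I_{n,\varphi}(\tau,v)},\qquad I_{n,\varphi}(\tau,v):=\inf_{k\in\mathbb N,\ k\ge n}\int_0^\tau\varphi\Big(\frac{\lambda_k t}{\lambda_n}\Big)\,dv(t).$$ Furthermore, there exists a function $v_*\in V(\tau)$ that realizes the infimum in the definition of $K_{n,\varphi}(\tau)$.
   Context: Almost periodic functions. A locally Lebesgue integrable $f:\mathbb R\to\mathbb C$ is called $B$-a.p. (Besicovitch almost periodic of order 1) if there are trigonometric sums $\tau_N(x)=\sum_{k} a_k e^{i\mu_k x}$ (finite sums, $\mu_k\in\mathbb R$, $a_k\in\mathbb C$) with $\limsup_{T\to\infty}\frac1{2T}\int_{-T}^T|f-\tau_N|\,dx\to0$ as $N\to\infty$. For such $f$ the mean value $A\{f\}=\lim_{T\to\infty}\frac1T\int_0^Tf(x)\,dx$ exists, and the Fourier exponents of $f$ are the (at most countably many) $\lambda\in\mathbb R$ with $A\{f(\cdot)e^{-i\lambda\cdot}\}\ne0$. Exponents. $\{\lambda_k\}_{k\in\mathbb Z}$ is a real sequence with $\lambda_0=0$, $\lambda_{-k}=-\lambda_k$,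 $0<\lambda_k<\lambda_{k+1}$ for $k\ge1$, and $\lambda_k\to\infty$ as $k\to\infty$. All functions considered are $B$-a.p. with all Fourier exponents in $\{\lambda_k\}_{k\in\mathbb Z}$; put $A_k(f)=A\{f(\cdot)e^{-i\lambda_k\cdot}\}$. We say $f$ has a Fourier series of the form $(F)$ if its Fourier series is $\sum_{k\in\mathbb Z}A_k(f)e^{i\lambda_kx}$ with $|A_k(f)|+|A_{-k}(f)|>0$ for all $k\ge 1$. The space. $\mathbf M=\{M_k\}_{k\in\mathbb Z}$ is a sequence of Orlicz functions: each $M_k:[0,\infty)\to[0,\infty)$ is nondecreasing and convex, $M_k(0)=0$, $M_k(t)\to\infty$ as $t\to\infty$. Let $M_k^*(v)=\sup\{uv-M_k(u):u\ge0\}$, and let $\Gamma$ be the set of sequences of positive numbers $\gamma=\{\gamma_k\}_{k\in\mathbb Z}$ with $\sum_{k\in\mathbb Z}M_k^*(\gamma_k)\le1$. The space $B\mathcal S_{\mathbf M}$ consists of those functions $f$ for which $\|f\|_{\mathbf M}:=\sup\{\sum_{k\in\mathbb Z}\gamma_k|A_k(f)|:\gamma\in\Gamma\}<\infty$; functions with the same Fourier series are identified. Best approximation. $E_{\lambda_n}(f)_{\mathbf M}=\inf\|f-g\|_{\mathbf M}$, the infimum over all $g$ whose Fourier exponents lie in the interval $(-\lambda_n,\lambda_n)$. Generalized modulus of smoothness. $\Phi$ is the set of continuous bounded nonnegative even functions $\varphi:\mathbb R\to\mathbb R$ with $\varphi(0)=0$ whose zero set has Lebesgue measure zero. For $\varphi\in\Phi$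 and $\delta\ge0$, $$\omega_\varphi(f,\delta)_{\mathbf M}=\sup_{|h|\le\delta}\ \sup\Big\{\sum_{k\in\mathbb Z}\gamma_k\varphi(\lambda_kh)|A_k(f)|:\gamma\in\Gamma\Big\}.$$ Weights. $V(\tau)$ is the set of bounded nondecreasing functions $v$ on $[0,\tau]$ that are not constant on $[0,\tau]$; integrals $dv$ are Riemann–Stieltjes integrals over $[0,\tau]$. Convention: $c/0=+\infty$ for $c>0$ (if $K_{n,\varphi}(\tau)=+\infty$ the inequality is trivially true). *)

theory Defs
  imports "HOL-Analysis.Analysis"
begin

section \<open>Besicovitch almost periodic functions\<close>

definition trig_sum :: "(real \<Rightarrow> complex) \<Rightarrow> bool" where
  "trig_sum p \<longleftrightarrow>
     (\<exists>S a. finite S \<and> p = (\<lambda>x. \<Sum>\<mu>\<in>S. a \<mu> * exp (\<i> * complex_of_real (\<mu> * x))))"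

definition B_ap :: "(real \<Rightarrow> complex) \<Rightarrow> bool" where
  "B_ap f \<longleftrightarrow>
     (\<forall>a b. set_integrable lebesgue {a..b} f) \<and>
     (\<exists>p. (\<forall>N. trig_sum (p N)) \<and>
        (\<lambda>N::nat. Limsup at_top
           (\<lambda>T. ereal (1 / (2 * T) * (LINT x:{-T..T}|lebesgue. cmod (f x - p N x)))))
        \<longlonglongrightarrow> 0)"

definition mean_value :: "(real \<Rightarrow> complex) \<Rightarrow> complex" where
  "mean_value f = Lim at_top (\<lambda>T. complex_of_real (1 / T) * (LINT x:{0..T}|lebesgue. f x))"

definition fourier_coeff :: "(real \<Rightarrow> complex) \<Rightarrow> real \<Rightarrow> complex" where
  "fourier_coeff f \<mu> = mean_value (\<lambda>x. f x * exp (- \<i> * complex_of_real (\<mu> * x)))"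

definition fourier_exponents :: "(real \<Rightarrow> complex) \<Rightarrow> real set" where
  "fourier_exponents f = {\<mu>. fourier_coeff f \<mu> \<noteq> 0}"

definition exponent_seq :: "(int \<Rightarrow> real) \<Rightarrow> bool" where
  "exponent_seq \<Lambda> \<longleftrightarrow>
     \<Lambda> 0 = 0 \<and> (\<forall>k. \<Lambda> (- k) = - \<Lambda> k) \<and> (\<forall>k\<ge>1. 0 < \<Lambda> k \<and> \<Lambda> k < \<Lambda> (k + 1)) \<and>
     filterlim \<Lambda> at_top at_top"

definition B_ap_on :: "(int \<Rightarrow> real) \<Rightarrow> (real \<Rightarrow> complex) \<Rightarrow> bool" where
  "B_ap_on \<Lambda> f \<longleftrightarrow> B_ap f \<and> fourier_exponents f \<subseteq> range \<Lambda>"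

definition form_F :: "(int \<Rightarrow> real) \<Rightarrow> (real \<Rightarrow> complex) \<Rightarrow> bool" where
  "form_F \<Lambda> f \<longleftrightarrow> B_ap_on \<Lambda> f \<and>
     (\<forall>k\<ge>1. cmod (fourier_coeff f (\<Lambda> k)) + cmod (fourier_coeff f (\<Lambda> (- k))) > 0)"


section \<open>The spaces of Musielak-Orlicz type\<close>

text \<open>Orlicz functions live on the half-line: their values at negative arguments are irrelevant.\<close>

definition orlicz_fun :: "(real \<Rightarrow> real) \<Rightarrow> bool" where
  "orlicz_fun m \<longleftrightarrow>
     (\<forall>t\<ge>0. 0 \<le> m t) \<and> mono_on {0..} m \<and> convex_on {0..} m \<and> m 0 = 0 \<and>
     filterlim m at_top at_top"

definition conjugate_fun :: "(real \<Rightarrow> real) \<Rightarrow> real \<Rightarrow> ereal" where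
  "conjugate_fun m v = (SUP u\<in>{0..}. ereal (u * v - m u))"

definition Gamma_set :: "(int \<Rightarrow> real \<Rightarrow> real) \<Rightarrow> (int \<Rightarrow> real) set" where
  "Gamma_set M = {\<gamma>. (\<forall>k. 0 < \<gamma> k) \<and> (\<Sum>\<^sub>\<infinity>k\<in>UNIV. conjugate_fun (M k) (\<gamma> k)) \<le> 1}"

text \<open>The norm is extended-real-valued. It depends on the Fourier coefficients only, so functions
  with the same Fourier series need not be identified explicitly.\<close>

definition BS_norm :: "(int \<Rightarrow> real \<Rightarrow> real) \<Rightarrow> (int \<Rightarrow> real) \<Rightarrow> (real \<Rightarrow> complex) \<Rightarrow> ereal" where
  "BS_norm M \<Lambda> f =
     (SUP \<gamma>\<in>Gamma_set M. \<Sum>\<^sub>\<infinity>k\<in>UNIV. ereal (\<gamma> k * cmod (fourier_coeff f (\<Lambda> k))))"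

definition BS_space :: "(int \<Rightarrow> real \<Rightarrow> real) \<Rightarrow> (int \<Rightarrow> real) \<Rightarrow> (real \<Rightarrow> complex) set" where
  "BS_space M \<Lambda> = {f. B_ap_on \<Lambda> f \<and> BS_norm M \<Lambda> f < \<infinity>}"

definition best_approx ::
  "(int \<Rightarrow> real \<Rightarrow> real) \<Rightarrow> (int \<Rightarrow> real) \<Rightarrow> real \<Rightarrow> (real \<Rightarrow> complex) \<Rightarrow> ereal" where
  "best_approx M \<Lambda> r f =
     (INF g\<in>{g. B_ap_on \<Lambda> g \<and> fourier_exponents g \<subseteq> {-r<..<r}}. BS_norm M \<Lambda> (\<lambda>x. f x - g x))"


section \<open>Generalized modulus of smoothness\<close>

definition Phi_set :: "(real \<Rightarrow> real) set" where
  "Phi_set = {\<phi>. continuous_on UNIV \<phi> \<and> bounded (range \<phi>) \<and> (\<forall>t. 0 \<le> \<phi> t) \<and>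
     (\<forall>t. \<phi> (- t) = \<phi> t) \<and> \<phi> 0 = 0 \<and> {t. \<phi> t = 0} \<in> null_sets lebesgue}"

definition gen_modulus :: "(int \<Rightarrow> real \<Rightarrow> real) \<Rightarrow> (int \<Rightarrow> real) \<Rightarrow> (real \<Rightarrow> real) \<Rightarrow>
    (real \<Rightarrow> complex) \<Rightarrow> real \<Rightarrow> ereal" where
  "gen_modulus M \<Lambda> \<phi> f \<delta> =
     (SUP h\<in>{h. \<bar>h\<bar> \<le> \<delta>}. SUP \<gamma>\<in>Gamma_set M.
        \<Sum>\<^sub>\<infinity>k\<in>UNIV. ereal (\<gamma> k * \<phi> (\<Lambda> k * h) * cmod (fourier_coeff f (\<Lambda> k))))"


section \<open>Weights and the constants K\<close>

text \<open>Riemann-Stieltjes integral as the limit of Riemann-Stieltjes sums when the mesh tends to 0.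
  The library's tagged divisions may contain degenerate intervals; these contribute 0 to the sum.\<close>

definition has_RS_integral ::
  "(real \<Rightarrow> real) \<Rightarrow> (real \<Rightarrow> real) \<Rightarrow> real \<Rightarrow> real \<Rightarrow> real \<Rightarrow> bool" where
  "has_RS_integral g v a b I \<longleftrightarrow>
     (\<forall>e>0. \<exists>d>0. \<forall>p. p tagged_division_of {a..b} \<and> (\<forall>(x, J)\<in>p. Sup J - Inf J < d) \<longrightarrow>
        \<bar>(\<Sum>(x, J)\<in>p. g x * (v (Sup J) - v (Inf J))) - I\<bar> < e)"

definition RS_integral :: "(real \<Rightarrow> real) \<Rightarrow> (real \<Rightarrow> real) \<Rightarrow> real \<Rightarrow> real \<Rightarrow> real" where
  "RS_integral g v a b = (THE I. has_RS_integral g v a b I)"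

definition V_set :: "real \<Rightarrow> (real \<Rightarrow> real) set" where
  "V_set \<tau> = {v. bounded (v ` {0..\<tau>}) \<and> mono_on {0..\<tau>} v \<and> \<not> v constant_on {0..\<tau>}}"

definition I_const ::
  "(int \<Rightarrow> real) \<Rightarrow> nat \<Rightarrow> (real \<Rightarrow> real) \<Rightarrow> real \<Rightarrow> (real \<Rightarrow> real) \<Rightarrow> real" where
  "I_const \<Lambda> n \<phi> \<tau> v =
     (INF k\<in>{n..}. RS_integral (\<lambda>t. \<phi> (\<Lambda> (int k) * t / \<Lambda> (int n))) v 0 \<tau>)"

text \<open>Division in \<^typ>\<open>ereal\<close> satisfies \<open>c / 0 = \<infinity>\<close> for \<open>c > 0\<close>.\<close>

definition V_ratio ::
  "(int \<Rightarrow> real) \<Rightarrow> nat \<Rightarrow> (real \<Rightarrow> real) \<Rightarrow> real \<Rightarrow> (real \<Rightarrow> real) \<Rightarrow> ereal" where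
  "V_ratio \<Lambda> n \<phi> \<tau> v = ereal (v \<tau> - v 0) / ereal (I_const \<Lambda> n \<phi> \<tau> v)"

definition K_const :: "(int \<Rightarrow> real) \<Rightarrow> nat \<Rightarrow> (real \<Rightarrow> real) \<Rightarrow> real \<Rightarrow> ereal" where
  "K_const \<Lambda> n \<phi> \<tau> = (INF v\<in>V_set \<tau>. V_ratio \<Lambda> n \<phi> \<tau> v)"

end

theory Submission imports Defs begin

text \<open>
  Fix a weight \<open>v\<close> and a sequence \<open>\<gamma>\<close> of multipliers, and let \<open>a\<^sub>k\<close> be the modulus of the Fourier
  coefficient of \<open>f\<close> at \<open>\<Lambda> k\<close>. For \<open>0 \<le> t \<le> \<tau>\<close> the step \<open>h = t / \<Lambda> n\<close> is admissible in the modulus of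
  smoothness \<open>\<omega>\<close>, so that \<open>\<Sum> \<gamma>\<^sub>k \<phi> (\<Lambda> k * t / \<Lambda> n) a\<^sub>k \<le> \<omega>\<close>. Integrating over \<open>t\<close> with respect to \<open>v\<close> and
  keeping only the frequencies with \<open>\<bar>k\<bar> \<ge> n\<close>, for each of which the integral of \<open>\<phi>\<close> is at least
  \<open>I_const\<close>, gives \<open>I_const * \<Sum> \<gamma>\<^sub>k a\<^sub>k \<le> \<omega> * (v \<tau> - v 0)\<close> (lemma \<open>I_const_times_tail_le\<close>). The
  supremum of these sums over \<open>\<gamma>\<close> is the norm of \<open>f\<close> minus the partial sum of its Fourier series, and this
  partial sum is a competitor in the best approximation (lemma \<open>best_approx_le_if_tails_le\<close>). It remains to
  choose \<open>v\<close>.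

  The best \<open>v\<close> exists by compactness (lemma \<open>extremal_weight_exists\<close>). Weights of total mass 1 form a
  compact set for pointwise convergence, by Tychonoff's theorem. The integral of a fixed continuous function
  is a continuous function of the weight, since it is approximated by Riemann-Stieltjes sums at a rate that
  does not depend on the weight (lemma \<open>RS_integral_uniform_approx\<close>). Hence \<open>I_const\<close>, an infimum of such
  integrals, is upper semicontinuous and attains its maximum. Because the infimum in the constant is
  attained, the inequality has to be checked for the extremal weight only.

  Two points need care. Fourier coefficients are limits of means, and subtracting the partial sum
  coefficientwise requires these limits to exist (lemma \<open>B_ap_has_mean\<close>). If the constant is infinite, the
  product with \<open>\<omega>\<close> is infinite only for \<open>\<omega> > 0\<close>, which follows from the nonvanishing of the coefficients at
  \<open>\<Lambda> 1\<close> or \<open>\<Lambda> (- 1)\<close> (lemma \<open>gen_modulus_pos\<close>).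
\<close>

section \<open>Riemann-Stieltjes integrals of continuous functions against monotone functions\<close>

text \<open>The Riemann-Stieltjes sum of \<open>g\<close> over \<open>N\<close> cells of equal length, tagged at their left end points. Since it
  involves only finitely many values of \<open>v\<close>, it is manifestly continuous in \<open>v\<close> for pointwise convergence;
  this is the property that the integral inherits below.\<close>

definition uniform_RS_sum :: "(real \<Rightarrow> real) \<Rightarrow> (real \<Rightarrow> real) \<Rightarrow> real \<Rightarrow> real \<Rightarrow> nat \<Rightarrow> real" where
  "uniform_RS_sum g v a b N =
     (let x = (\<lambda>i. a + real i * ((b - a) / real N))
      in \<Sum>i<N. g (x i) * (v (x (Suc i)) - v (x i)))"

text \<open>For a common refinement of the two divisions one would have to intersect cells. Instead the function
  \<open>v\<close> is split: its increments over the cells of the uniform division are carried by monotone functions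
  \<open>c i\<close> whose sum is \<open>v - v a\<close>, and both sums become double sums over pairs of a tagged cell and a uniform
  cell. Such a pair carries weight only if the two cells meet, and then the tags are close, so that \<open>g\<close>
  changes by at most \<open>e\<close>. The weights are nonnegative with total \<open>v b - v a\<close>, and the bound depends on \<open>v\<close>
  only through this total.\<close>

lemma tagged_RS_sum_near_uniform:
  fixes g v :: "real \<Rightarrow> real"
  assumes ab: "a \<le> b" and v: "mono_on {a..b} v"
    and p: "p tagged_division_of {a..b}" and mesh: "\<forall>(x, J)\<in>p. Sup J - Inf J < d"
    and N: "N > 0" and osc: "\<And>x y. x \<in> {a..b} \<Longrightarrow> y \<in> {a..b} \<Longrightarrow>
      \<bar>x - y\<bar> \<le> (b - a) / real N + d \<Longrightarrow> \<bar>g x - g y\<bar> \<le> e"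
  shows "\<bar>(\<Sum>(x, J)\<in>p. g x * (v (Sup J) - v (Inf J))) - uniform_RS_sum g v a b N\<bar>
           \<le> e * (v b - v a)"
proof -
  define h where "h = (b - a) / real N"
  define X where "X i = a + real i * h" for i
  have h: "h \<ge> 0" using ab by (simp add: h_def)
  have X0: "X 0 = a" and XN: "X N = b" using N by (auto simp: X_def h_def)
  have X_step: "X (Suc i) = X i + h" for i by (simp add: X_def algebra_simps)
  have X_mono: "X i \<le> X j" if "i \<le> j" for i j
    using that h by (simp add: X_def mult_right_mono)
  have X_in: "X i \<in> {a..b}" if "i \<le> N" for i
    using X_mono[of 0 i] X_mono[of i N] that X0 XN by auto
  \<comment> \<open>The part of the increment of \<open>v\<close> that \<open>t\<close> has collected inside the \<open>i\<close>-th cell.\<close>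
  define c where "c i t = v (min (X (Suc i)) t) - v (min (X i) t)" for i t
  have c_sum: "(\<Sum>i<N. c i t) = v t - v a" if "t \<in> {a..b}" for t
  proof -
    have "(\<Sum>i<N. c i t) = v (min (X N) t) - v (min (X 0) t)"
      unfolding c_def by (rule sum_lessThan_telescope)
    moreover have "min (X N) t = t" "min (X 0) t = a" using that X0 XN by auto
    ultimately show ?thesis by simp
  qed
  have c_clamp: "c i t = v (max (X i) (min (X (Suc i)) t)) - v (X i)" for i t
    using X_mono[of i "Suc i"] by (auto simp: c_def min_def max_def)
  have c_mono: "c i s \<le> c i t" if "s \<le> t" "i < N" for i s t
  proof -
    have "v (max (X i) (min (X (Suc i)) s)) \<le> v (max (X i) (min (X (Suc i)) t))"
      using that X_in[of i] X_in[of "Suc i"] by (intro mono_onD[OF v]) (auto simp: min_def max_def)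
    then show ?thesis by (simp add: c_clamp)
  qed
  have cell: "J \<noteq> {} \<and> Inf J \<in> {a..b} \<and> Sup J \<in> {a..b} \<and> x \<in> {Inf J..Sup J}" if xJ: "(x, J) \<in> p" for x J
  proof -
    obtain l u where J: "J = {l..u}" using tagged_division_ofD(4)[OF p xJ] by auto
    have "x \<in> J" "J \<subseteq> {a..b}" using tagged_division_ofD(2,3)[OF p xJ] by auto
    then show ?thesis using J by auto
  qed
  have S: "(\<Sum>(x, J)\<in>p. g x * (v (Sup J) - v (Inf J)))
      = (\<Sum>(x, J)\<in>p. \<Sum>i<N. g x * (c i (Sup J) - c i (Inf J)))"
  proof (rule sum.cong[OF refl], clarify)
    fix x J assume "(x, J) \<in> p"
    from cell[OF this] show "g x * (v (Sup J) - v (Inf J)) = (\<Sum>i<N. g x * (c i (Sup J) - c i (Inf J)))"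
      by (simp add: c_sum sum_subtractf flip: sum_distrib_left)
  qed
  have tele: "(\<Sum>(x, J)\<in>p. c i (Sup J) - c i (Inf J)) = v (X (Suc i)) - v (X i)" if "i < N" for i
  proof -
    have "(\<Sum>(x, J)\<in>p. c i (Sup J) - c i (Inf J)) = c i b - c i a"
      by (rule additive_tagged_division_1[OF ab p])
    then show ?thesis using X_in[of i] X_in[of "Suc i"] that by (auto simp: c_def min_def)
  qed
  have "uniform_RS_sum g v a b N = (\<Sum>i<N. g (X i) * (v (X (Suc i)) - v (X i)))"
    by (simp add: uniform_RS_sum_def Let_def X_def h_def)
  also have "\<dots> = (\<Sum>i<N. \<Sum>(x, J)\<in>p. g (X i) * (c i (Sup J) - c i (Inf J)))"
    by (intro sum.cong refl) (simp add: sum_distrib_left case_prod_unfold flip: tele)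
  also have "\<dots> = (\<Sum>(x, J)\<in>p. \<Sum>i<N. g (X i) * (c i (Sup J) - c i (Inf J)))"
    unfolding case_prod_unfold by (rule sum.swap)
  finally have "\<bar>(\<Sum>(x, J)\<in>p. g x * (v (Sup J) - v (Inf J))) - uniform_RS_sum g v a b N\<bar>
      = \<bar>\<Sum>(x, J)\<in>p. \<Sum>i<N. (g x - g (X i)) * (c i (Sup J) - c i (Inf J))\<bar>"
    unfolding S by (simp add: sum_subtractf case_prod_unfold left_diff_distrib)
  also have "\<dots> \<le> (\<Sum>(x, J)\<in>p. \<Sum>i<N. \<bar>(g x - g (X i)) * (c i (Sup J) - c i (Inf J))\<bar>)"
    unfolding case_prod_unfold by (intro order_trans[OF sum_abs] sum_mono order_refl sum_abs)
  also have "\<dots> \<le> (\<Sum>(x, J)\<in>p. \<Sum>i<N. e * (c i (Sup J) - c i (Inf J)))"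
  proof (intro sum_mono, clarify, rule sum_mono)
    fix x J i assume pJ: "(x, J) \<in> p" and "i \<in> {..<N}"
    then have i: "i < N" by simp
    have d: "Sup J - Inf J < d" using mesh pJ by auto
    note J = cell[OF pJ]
    have ge: "0 \<le> c i (Sup J) - c i (Inf J)" using c_mono[OF _ i, of "Inf J" "Sup J"] J by auto
    show "\<bar>(g x - g (X i)) * (c i (Sup J) - c i (Inf J))\<bar> \<le> e * (c i (Sup J) - c i (Inf J))"
    proof (cases "Inf J \<le> X (Suc i) \<and> X i \<le> Sup J")
      case True
      then have "\<bar>x - X i\<bar> \<le> (b - a) / real N + d"
        using J d X_step[of i] h unfolding h_def[symmetric] by auto
      then have "\<bar>g x - g (X i)\<bar> \<le> e" using J i X_in[of i] by (intro osc) auto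
      then show ?thesis using ge by (simp add: abs_mult mult_right_mono)
    next
      case False
      then have "c i (Sup J) = c i (Inf J)"
        using J X_mono[of i "Suc i"] by (auto simp: c_def min_def)
      then show ?thesis by simp
    qed
  qed
  also have "\<dots> = e * (\<Sum>(x, J)\<in>p. v (Sup J) - v (Inf J))"
    unfolding sum_distrib_left case_prod_unfold
  proof (rule sum.cong[OF refl])
    fix z assume "z \<in> p"
    then have "(fst z, snd z) \<in> p" by simp
    from cell[OF this] show "(\<Sum>i<N. e * (c i (Sup (snd z)) - c i (Inf (snd z)))) = e * (v (Sup (snd z)) - v (Inf (snd z)))"
      by (simp add: c_sum sum_subtractf flip: sum_distrib_left)
  qed
  also have "(\<Sum>(x, J)\<in>p. v (Sup J) - v (Inf J)) = v b - v a"
    by (rule additive_tagged_division_1[OF ab p])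
  finally show ?thesis .
qed

lemma fine_tagged_division_exists:
  assumes "d > 0"
  obtains p where "p tagged_division_of {a..b::real}" "\<forall>(x, J)\<in>p. Sup J - Inf J < d"
proof -
  obtain p where p: "p tagged_division_of {a..b}" "(\<lambda>x. ball x (d / 3)) fine p"
    using fine_division_exists_real[OF gauge_ball, of "d / 3" a b] assms by auto
  have "Sup J - Inf J < d" if xJ: "(x, J) \<in> p" for x J
  proof -
    obtain l u where J: "J = {l..u}" using tagged_division_ofD(4)[OF p(1) xJ] by auto
    have "J \<subseteq> ball x (d / 3)" "x \<in> J"
      using p(2) xJ tagged_division_ofD(2)[OF p(1) xJ] by (auto simp: fine_def)
    then have "l \<in> ball x (d / 3)" "u \<in> ball x (d / 3)" "l \<le> u" using J by (auto simp del: mem_ball)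
    then show ?thesis using J assms by (simp add: dist_real_def abs_if split: if_splits)
  qed
  then show ?thesis using p(1) that by blast
qed

lemma has_RS_integral_unique:
  assumes "has_RS_integral g v a b I" "has_RS_integral g v a b I'"
  shows "I = I'"
proof (rule ccontr)
  assume "I \<noteq> I'"
  then have e: "\<bar>I - I'\<bar> / 2 > 0" by simp
  obtain d where d: "d > 0" "\<And>p. p tagged_division_of {a..b} \<and> (\<forall>(x, J)\<in>p. Sup J - Inf J < d) \<Longrightarrow>
      \<bar>(\<Sum>(x, J)\<in>p. g x * (v (Sup J) - v (Inf J))) - I\<bar> < \<bar>I - I'\<bar> / 2"
    using assms(1) e unfolding has_RS_integral_def by meson
  obtain d' where d': "d' > 0" "\<And>p. p tagged_division_of {a..b} \<and> (\<forall>(x, J)\<in>p. Sup J - Inf J < d') \<Longrightarrow>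
      \<bar>(\<Sum>(x, J)\<in>p. g x * (v (Sup J) - v (Inf J))) - I'\<bar> < \<bar>I - I'\<bar> / 2"
    using assms(2) e unfolding has_RS_integral_def by meson
  obtain p where p: "p tagged_division_of {a..b}" "\<forall>(x, J)\<in>p. Sup J - Inf J < min d d'"
    using fine_tagged_division_exists[of "min d d'" a b] d(1) d'(1) by auto
  have "\<forall>(x, J)\<in>p. Sup J - Inf J < d" "\<forall>(x, J)\<in>p. Sup J - Inf J < d'" using p(2) by auto
  note close = d(2)[OF conjI[OF p(1) this(1)]] d'(2)[OF conjI[OF p(1) this(2)]]
  have "\<bar>S - I\<bar> < \<bar>I - I'\<bar> / 2 \<Longrightarrow> \<bar>S - I'\<bar> < \<bar>I - I'\<bar> / 2 \<Longrightarrow> False" for S by argo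
  from this[OF close] show False .
qed

text \<open>Uniform continuity of \<open>g\<close> alone determines how fine the divisions have to be. That the same
  threshold serves every monotone \<open>v\<close> is what makes the integral continuous in \<open>v\<close>.\<close>

lemma tagged_RS_sums_near_uniform:
  fixes g :: "real \<Rightarrow> real"
  assumes ab: "a \<le> b" and g: "continuous_on {a..b} g" and e: "e > 0"
  obtains N0 d where "N0 > 0" "d > 0" "\<And>N p (v :: real \<Rightarrow> real). N \<ge> N0 \<Longrightarrow> mono_on {a..b} v \<Longrightarrow>
    p tagged_division_of {a..b} \<Longrightarrow> \<forall>(x, J)\<in>p. Sup J - Inf J < d \<Longrightarrow>
    \<bar>(\<Sum>(x, J)\<in>p. g x * (v (Sup J) - v (Inf J))) - uniform_RS_sum g v a b N\<bar> \<le> e * (v b - v a)"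
proof -
  have "uniformly_continuous_on {a..b} g"
    using compact_uniformly_continuous[OF g] by simp
  then obtain d where d: "d > 0"
    "\<And>x y. x \<in> {a..b} \<Longrightarrow> y \<in> {a..b} \<Longrightarrow> dist y x < d \<Longrightarrow> dist (g y) (g x) < e"
    using e unfolding uniformly_continuous_on_def by blast
  obtain N0 :: nat where N0: "N0 > 0" "(b - a) / real N0 < d / 2"
  proof -
    obtain m :: nat where m: "(b - a) / (d / 2) < real m" using reals_Archimedean2 by blast
    have "(b - a) / real (Suc m) < d / 2"
      using m d(1) by (simp add: field_simps)
    then show ?thesis using that[of "Suc m"] by simp
  qed
  show ?thesis
  proof (rule that[of N0 "d / 2"])
    show "N0 > 0" "d / 2 > 0" using N0 d by auto
    fix N p and v :: "real \<Rightarrow> real"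
    assume N: "N0 \<le> N" and v: "mono_on {a..b} v" and p: "p tagged_division_of {a..b}"
      and mesh: "\<forall>(x, J)\<in>p. Sup J - Inf J < d / 2"
    have "(b - a) / real N \<le> (b - a) / real N0"
      using N N0(1) ab by (intro divide_left_mono) auto
    then have small: "(b - a) / real N + d / 2 < d" using N0(2) by linarith
    show "\<bar>(\<Sum>(x, J)\<in>p. g x * (v (Sup J) - v (Inf J))) - uniform_RS_sum g v a b N\<bar> \<le> e * (v b - v a)"
    proof (rule tagged_RS_sum_near_uniform[OF ab v p mesh])
      fix x y assume "x \<in> {a..b}" "y \<in> {a..b}" "\<bar>x - y\<bar> \<le> (b - a) / real N + d / 2"
      then show "\<bar>g x - g y\<bar> \<le> e" using d(2)[of y x] small by (simp add: dist_real_def)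
    qed (use N N0 in simp)
  qed
qed

text \<open>A single sufficiently fine tagged division is close to all late uniform sums, which therefore form a
  Cauchy sequence; conversely their limit is close to every fine tagged sum.\<close>

lemma has_RS_integral_lim_uniform:
  fixes g :: "real \<Rightarrow> real" and v :: "real \<Rightarrow> real"
  assumes ab: "a \<le> b" and g: "continuous_on {a..b} g" and v: "mono_on {a..b} v"
  obtains I where "has_RS_integral g v a b I" "uniform_RS_sum g v a b \<longlonglongrightarrow> I"
proof -
  define C where "C = v b - v a + 1"
  have C: "C > 0" "v b - v a \<le> C" using mono_onD[OF v, of a b] ab by (auto simp: C_def)
  have near: "\<exists>N0 d. d > 0 \<and> (\<forall>N\<ge>N0. \<forall>p. p tagged_division_of {a..b} \<longrightarrow> (\<forall>(x, J)\<in>p. Sup J - Inf J < d) \<longrightarrow>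
      \<bar>(\<Sum>(x, J)\<in>p. g x * (v (Sup J) - v (Inf J))) - uniform_RS_sum g v a b N\<bar> \<le> r)"
    if r: "r > 0" for r
  proof -
    have "r / C > 0" using r C by simp
    then obtain N0 d where *: "N0 > 0" "d > 0" "\<And>N p (v :: real \<Rightarrow> real). N \<ge> N0 \<Longrightarrow> mono_on {a..b} v \<Longrightarrow>
        p tagged_division_of {a..b} \<Longrightarrow> \<forall>(x, J)\<in>p. Sup J - Inf J < d \<Longrightarrow>
        \<bar>(\<Sum>(x, J)\<in>p. g x * (v (Sup J) - v (Inf J))) - uniform_RS_sum g v a b N\<bar> \<le> r / C * (v b - v a)"
      using tagged_RS_sums_near_uniform[OF ab g, of "r / C"] by blast
    have "r / C * (v b - v a) \<le> r / C * C" using C r by (intro mult_left_mono) auto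
    then have "r / C * (v b - v a) \<le> r" using C by simp
    then show ?thesis using *(2) order_trans[OF *(3)[OF _ v]] by (intro exI[of _ N0] exI[of _ d]) simp
  qed
  have "Cauchy (uniform_RS_sum g v a b)"
  proof (rule CauchyI)
    fix r :: real assume r: "r > 0"
    then have "r / 3 > 0" by simp
    from near[OF this] obtain N0 d where *: "d > 0" "\<And>N p. N \<ge> N0 \<Longrightarrow> p tagged_division_of {a..b} \<Longrightarrow>
        (\<forall>(x, J)\<in>p. Sup J - Inf J < d) \<Longrightarrow>
        \<bar>(\<Sum>(x, J)\<in>p. g x * (v (Sup J) - v (Inf J))) - uniform_RS_sum g v a b N\<bar> \<le> r / 3"
      by blast
    obtain p where p: "p tagged_division_of {a..b}" "\<forall>(x, J)\<in>p. Sup J - Inf J < d"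
      using fine_tagged_division_exists[OF *(1), of a b] by blast
    have "norm (uniform_RS_sum g v a b m - uniform_RS_sum g v a b k) < r" if "m \<ge> N0" "k \<ge> N0" for m k
      using *(2)[OF that(1) p] *(2)[OF that(2) p] r unfolding real_norm_def by linarith
    then show "\<exists>M. \<forall>m\<ge>M. \<forall>k\<ge>M. norm (uniform_RS_sum g v a b m - uniform_RS_sum g v a b k) < r"
      by blast
  qed
  then obtain I where I: "uniform_RS_sum g v a b \<longlonglongrightarrow> I"
    using Cauchy_convergent_iff convergent_def by blast
  have "has_RS_integral g v a b I" unfolding has_RS_integral_def
  proof (intro allI impI)
    fix r :: real assume r: "r > 0"
    then have "r / 2 > 0" by simp
    from near[OF this] obtain N0 d where *: "d > 0" "\<And>N p. N \<ge> N0 \<Longrightarrow> p tagged_division_of {a..b} \<Longrightarrow>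
        (\<forall>(x, J)\<in>p. Sup J - Inf J < d) \<Longrightarrow>
        \<bar>(\<Sum>(x, J)\<in>p. g x * (v (Sup J) - v (Inf J))) - uniform_RS_sum g v a b N\<bar> \<le> r / 2"
      by blast
    show "\<exists>d>0. \<forall>p. p tagged_division_of {a..b} \<and> (\<forall>(x, J)\<in>p. Sup J - Inf J < d) \<longrightarrow>
      \<bar>(\<Sum>(x, J)\<in>p. g x * (v (Sup J) - v (Inf J))) - I\<bar> < r"
    proof (intro exI[of _ d] conjI allI impI)
      fix p assume p: "p tagged_division_of {a..b} \<and> (\<forall>(x, J)\<in>p. Sup J - Inf J < d)"
      let ?S = "\<Sum>(x, J)\<in>p. g x * (v (Sup J) - v (Inf J))"
      have "(\<lambda>N. \<bar>?S - uniform_RS_sum g v a b N\<bar>) \<longlonglongrightarrow> \<bar>?S - I\<bar>"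
        by (intro tendsto_intros I)
      then have "\<bar>?S - I\<bar> \<le> r / 2"
        by (rule LIMSEQ_le_const2) (use *(2) p in blast)
      then show "\<bar>?S - I\<bar> < r" using r by linarith
    qed (rule *(1))
  qed
  then show ?thesis using I that by blast
qed

text \<open>From here on the integral is handled as the limit of one explicit sequence, and linearity and
  monotonicity are read off from the sums.\<close>

lemma uniform_RS_sum_tendsto:
  fixes g :: "real \<Rightarrow> real" and v :: "real \<Rightarrow> real"
  assumes "a \<le> b" "continuous_on {a..b} g" "mono_on {a..b} v"
  shows "uniform_RS_sum g v a b \<longlonglongrightarrow> RS_integral g v a b"
proof -
  obtain I where I: "has_RS_integral g v a b I" "uniform_RS_sum g v a b \<longlonglongrightarrow> I"
    using has_RS_integral_lim_uniform[OF assms] .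
  have "RS_integral g v a b = I"
    unfolding RS_integral_def using I(1) has_RS_integral_unique by (intro the_equality) blast+
  then show ?thesis using I(2) by simp
qed

text \<open>The rate of convergence depends on \<open>v\<close> only through its total increment.\<close>

lemma RS_integral_uniform_approx:
  fixes g :: "real \<Rightarrow> real"
  assumes ab: "a \<le> b" and g: "continuous_on {a..b} g" and e: "e > 0"
  obtains N0 where "\<And>N (v :: real \<Rightarrow> real). N \<ge> N0 \<Longrightarrow> mono_on {a..b} v \<Longrightarrow>
    \<bar>uniform_RS_sum g v a b N - RS_integral g v a b\<bar> \<le> e * (v b - v a)"
proof -
  have "e / 2 > 0" using e by simp
  then obtain N0 d where *: "N0 > 0" "d > 0" "\<And>N p (v :: real \<Rightarrow> real). N \<ge> N0 \<Longrightarrow> mono_on {a..b} v \<Longrightarrow>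
      p tagged_division_of {a..b} \<Longrightarrow> \<forall>(x, J)\<in>p. Sup J - Inf J < d \<Longrightarrow>
      \<bar>(\<Sum>(x, J)\<in>p. g x * (v (Sup J) - v (Inf J))) - uniform_RS_sum g v a b N\<bar> \<le> e / 2 * (v b - v a)"
    using tagged_RS_sums_near_uniform[OF ab g, of "e / 2"] by blast
  obtain p where p: "p tagged_division_of {a..b}" "\<forall>(x, J)\<in>p. Sup J - Inf J < d"
    using fine_tagged_division_exists[OF *(2), of a b] by blast
  show ?thesis
  proof (rule that[of N0])
    fix N and v :: "real \<Rightarrow> real" assume N: "N0 \<le> N" and v: "mono_on {a..b} v"
    have "(\<lambda>m. \<bar>uniform_RS_sum g v a b N - uniform_RS_sum g v a b m\<bar>)
        \<longlonglongrightarrow> \<bar>uniform_RS_sum g v a b N - RS_integral g v a b\<bar>"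
      by (intro tendsto_intros uniform_RS_sum_tendsto ab g v)
    then show "\<bar>uniform_RS_sum g v a b N - RS_integral g v a b\<bar> \<le> e * (v b - v a)"
    proof (rule LIMSEQ_le_const2, intro exI allI impI)
      fix m assume m: "N0 \<le> m"
      have "e * (v b - v a) = e / 2 * (v b - v a) + e / 2 * (v b - v a)" by (simp add: field_simps)
      then show "\<bar>uniform_RS_sum g v a b N - uniform_RS_sum g v a b m\<bar> \<le> e * (v b - v a)"
        using *(3)[OF N v p] *(3)[OF m v p] by linarith
    qed
  qed
qed

lemma RS_integral_sum:
  assumes ab: "a \<le> b" and v: "mono_on {a..b} v"
    and g: "\<And>k. k \<in> F \<Longrightarrow> continuous_on {a..b} (g k)"
  shows "RS_integral (\<lambda>t. \<Sum>k\<in>F. c k * g k t) v a b = (\<Sum>k\<in>F. c k * RS_integral (g k) v a b)"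
proof -
  have "uniform_RS_sum (\<lambda>t. \<Sum>k\<in>F. c k * g k t) v a b N = (\<Sum>k\<in>F. c k * uniform_RS_sum (g k) v a b N)" for N
    unfolding uniform_RS_sum_def Let_def sum_distrib_left sum_distrib_right
    by (subst sum.swap) (simp add: mult.assoc)
  moreover have "(\<lambda>N. \<Sum>k\<in>F. c k * uniform_RS_sum (g k) v a b N) \<longlonglongrightarrow> (\<Sum>k\<in>F. c k * RS_integral (g k) v a b)"
    by (intro tendsto_intros uniform_RS_sum_tendsto ab v g)
  ultimately have "uniform_RS_sum (\<lambda>t. \<Sum>k\<in>F. c k * g k t) v a b \<longlonglongrightarrow> (\<Sum>k\<in>F. c k * RS_integral (g k) v a b)"
    by presburger
  moreover have "uniform_RS_sum (\<lambda>t. \<Sum>k\<in>F. c k * g k t) v a b \<longlonglongrightarrow> RS_integral (\<lambda>t. \<Sum>k\<in>F. c k * g k t) v a b"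
    by (intro uniform_RS_sum_tendsto ab v continuous_intros g)
  ultimately show ?thesis by (rule LIMSEQ_unique[symmetric])
qed

lemma uniform_RS_sum_mono:
  assumes ab: "a \<le> b" and v: "mono_on {a..b} v" and le: "\<And>t. t \<in> {a..b} \<Longrightarrow> g t \<le> h t"
  shows "uniform_RS_sum g v a b N \<le> uniform_RS_sum h v a b N"
proof (cases "N = 0")
  case False
  have X: "a + real i * ((b - a) / real N) \<in> {a..b}" if "i \<le> N" for i
  proof -
    have "real i * ((b - a) / real N) \<le> real N * ((b - a) / real N)"
      using that ab by (intro mult_right_mono) auto
    then show ?thesis using False ab by auto
  qed
  show ?thesis unfolding uniform_RS_sum_def Let_def
  proof (rule sum_mono)
    fix i assume "i \<in> {..<N}"
    then have i: "i \<le> N" "Suc i \<le> N" by auto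
    have "real i * ((b - a) / real N) \<le> real (Suc i) * ((b - a) / real N)"
      using ab by (intro mult_right_mono) auto
    then have "v (a + real i * ((b - a) / real N)) \<le> v (a + real (Suc i) * ((b - a) / real N))"
      using X[OF i(1)] X[OF i(2)] by (intro mono_onD[OF v]) auto
    then show "g (a + real i * ((b - a) / real N)) * (v (a + real (Suc i) * ((b - a) / real N)) - v (a + real i * ((b - a) / real N)))
      \<le> h (a + real i * ((b - a) / real N)) * (v (a + real (Suc i) * ((b - a) / real N)) - v (a + real i * ((b - a) / real N)))"
      using le[OF X[OF i(1)]] by (intro mult_right_mono) auto
  qed
qed (simp add: uniform_RS_sum_def)

lemma RS_integral_mono:
  assumes "a \<le> b" "continuous_on {a..b} g" "continuous_on {a..b} h" "mono_on {a..b} v"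
    and "\<And>t. t \<in> {a..b} \<Longrightarrow> g t \<le> h t"
  shows "RS_integral g v a b \<le> RS_integral h v a b"
  using uniform_RS_sum_tendsto[OF assms(1,2,4)] uniform_RS_sum_tendsto[OF assms(1,3,4)]
    uniform_RS_sum_mono[OF assms(1,4,5)]
  by (intro LIMSEQ_le) auto

lemma RS_integral_const:
  assumes ab: "a \<le> b" and v: "mono_on {a..b} v"
  shows "RS_integral (\<lambda>t. c) v a b = c * (v b - v a)"
proof -
  have "uniform_RS_sum (\<lambda>t. c) v a b N = c * (v b - v a)" if "N > 0" for N
  proof -
    have "uniform_RS_sum (\<lambda>t. c) v a b N
        = c * (v (a + real N * ((b - a) / real N)) - v (a + real 0 * ((b - a) / real N)))"
      unfolding uniform_RS_sum_def Let_def sum_distrib_left[symmetric]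
      by (subst sum_lessThan_telescope[where f = "\<lambda>i. v (a + real i * ((b - a) / real N))"]) simp
    then show ?thesis using that by simp
  qed
  then have "uniform_RS_sum (\<lambda>t. c) v a b \<longlonglongrightarrow> c * (v b - v a)"
    by (intro tendsto_eventually eventually_sequentiallyI[of 1]) auto
  then show ?thesis
    using uniform_RS_sum_tendsto[OF ab continuous_on_const v] LIMSEQ_unique by blast
qed

section \<open>Compactness of the set of normalised weights\<close>

text \<open>The weights normalised to total mass 1. Their values are confined to the unit interval on the whole
  line, not only on \<open>{0..\<tau>}\<close>, so that the set lies in a product of compact intervals.\<close>

definition cumulative_dist :: "real \<Rightarrow> (real \<Rightarrow> real) set" where
  "cumulative_dist \<tau> = {v. (\<forall>x. v x \<in> {0..1}) \<and> mono_on {0..\<tau>} v \<and> v 0 = 0 \<and> v \<tau> = 1}"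

text \<open>Tychonoff's theorem, in place of Helly's selection theorem: a product of copies of the unit interval
  is compact, and the remaining conditions compare values at finitely many points at a time, hence are
  closed under pointwise convergence.\<close>

lemma compact_cumulative_dist: "compact (cumulative_dist \<tau>)"
proof -
  have "compactin (product_topology (\<lambda>_::real. euclidean) UNIV) (Pi\<^sub>E UNIV (\<lambda>_. {0..1::real}))"
    by (subst compactin_PiE) auto
  then have "compact (Pi\<^sub>E UNIV (\<lambda>_::real. {0..1::real}))"
    by (simp add: euclidean_product_topology)
  moreover have "closed ((\<Inter>x\<in>{0..\<tau>}. \<Inter>y\<in>{x..\<tau>}. {v :: real \<Rightarrow> real. v x \<le> v y}) \<inter> {v. v 0 = 0} \<inter> {v. v \<tau> = 1})"
    by (intro closed_Int closed_INT ballI closed_Collect_le closed_Collect_eq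
        continuous_on_product_coordinates continuous_on_const)
  ultimately have "compact (Pi\<^sub>E UNIV (\<lambda>_::real. {0..1::real}) \<inter>
      ((\<Inter>x\<in>{0..\<tau>}. \<Inter>y\<in>{x..\<tau>}. {v :: real \<Rightarrow> real. v x \<le> v y}) \<inter> {v. v 0 = 0} \<inter> {v. v \<tau> = 1}))"
    by (rule compact_Int_closed)
  moreover have "Pi\<^sub>E UNIV (\<lambda>_::real. {0..1::real}) \<inter>
      ((\<Inter>x\<in>{0..\<tau>}. \<Inter>y\<in>{x..\<tau>}. {v :: real \<Rightarrow> real. v x \<le> v y}) \<inter> {v. v 0 = 0} \<inter> {v. v \<tau> = 1})
      = cumulative_dist \<tau>"
    by (auto simp: cumulative_dist_def mono_on_def PiE_iff)
  ultimately show ?thesis by simp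
qed

text \<open>Riemann-Stieltjes sums are continuous in the weight and converge uniformly on the set of weights of
  total mass 1.\<close>

lemma continuous_on_RS_integral:
  assumes \<tau>: "0 \<le> \<tau>" and g: "continuous_on {0..\<tau>} g"
  shows "continuous_on (cumulative_dist \<tau>) (\<lambda>v. RS_integral g v 0 \<tau>)"
proof (rule uniform_limit_theorem)
  show "\<forall>\<^sub>F N in sequentially. continuous_on (cumulative_dist \<tau>) (\<lambda>v. uniform_RS_sum g v 0 \<tau> N)"
    unfolding uniform_RS_sum_def Let_def
    by (intro always_eventually allI continuous_intros
        continuous_on_subset[OF continuous_on_product_coordinates subset_UNIV])
  show "uniform_limit (cumulative_dist \<tau>) (\<lambda>N v. uniform_RS_sum g v 0 \<tau> N)
      (\<lambda>v. RS_integral g v 0 \<tau>) sequentially"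
  proof (rule uniform_limitI)
    fix e :: real assume e: "e > 0"
    obtain N0 where N0: "\<And>N v. N \<ge> N0 \<Longrightarrow> mono_on {0..\<tau>} v \<Longrightarrow>
        \<bar>uniform_RS_sum g v 0 \<tau> N - RS_integral g v 0 \<tau>\<bar> \<le> e / 2 * (v \<tau> - v 0)"
      using RS_integral_uniform_approx[OF \<tau> g, of "e / 2"] e by (metis half_gt_zero)
    show "\<forall>\<^sub>F N in sequentially. \<forall>v\<in>cumulative_dist \<tau>.
        dist (uniform_RS_sum g v 0 \<tau> N) (RS_integral g v 0 \<tau>) < e"
    proof (rule eventually_sequentiallyI[of N0], rule ballI)
      fix N v assume "N0 \<le> N" "v \<in> cumulative_dist \<tau>"
      then show "dist (uniform_RS_sum g v 0 \<tau> N) (RS_integral g v 0 \<tau>) < e"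
        using N0[of N v] e by (auto simp: cumulative_dist_def dist_real_def)
    qed
  qed
qed simp

text \<open>An infimum of continuous functions is upper semicontinuous, so it attains its supremum on a compact
  set: the superlevel sets through the points of \<open>X\<close> are closed and any finitely many of them share the
  best of the finitely many points.\<close>

lemma compact_attains_sup_INF:
  fixes G :: "'i \<Rightarrow> 'a::topological_space \<Rightarrow> real"
  assumes X: "compact X" "X \<noteq> {}" and G: "\<And>k. k \<in> S \<Longrightarrow> continuous_on X (G k)"
    and S: "S \<noteq> {}" and bdd: "\<And>x. x \<in> X \<Longrightarrow> bdd_below ((\<lambda>k. G k x) ` S)"
  obtains x where "x \<in> X" "\<And>y. y \<in> X \<Longrightarrow> (INF k\<in>S. G k y) \<le> (INF k\<in>S. G k x)"
proof -
  define I where "I x = (INF k\<in>S. G k x)" for x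
  define D where "D y = (\<Inter>k\<in>S. {x\<in>X. I y \<le> G k x})" for y
  have "closedin (top_of_set X) {x\<in>X. I y \<le> G k x}" if k: "k \<in> S" for y k
  proof -
    have "{x\<in>X. I y \<le> G k x} = X \<inter> G k -` {I y..}" by auto
    then show ?thesis using continuous_closedin_preimage[OF G[OF k] closed_atLeast] by simp
  qed
  then have "closedin (top_of_set X) (D y)" for y
    using S closedin_INT[of S "top_of_set X" "\<lambda>k. {x\<in>X. I y \<le> G k x}"] unfolding D_def by simp
  then have "\<forall>y. \<exists>T. closed T \<and> D y = X \<inter> T" unfolding closedin_closed by blast
  then obtain C where C: "\<forall>y. closed (C y) \<and> D y = X \<inter> C y" by (rule choice[THEN exE])
  have in_C: "x \<in> C y \<longleftrightarrow> (\<forall>k\<in>S. I y \<le> G k x)" if x: "x \<in> X" for x y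
  proof -
    have "x \<in> C y \<longleftrightarrow> x \<in> D y" using C x by blast
    then show ?thesis using x unfolding D_def by blast
  qed
  have "closed (C y)" for y using C by blast
  moreover have "X \<inter> (\<Inter>y\<in>F. C y) \<noteq> {}" if F: "finite F" "F \<subseteq> X" for F
  proof (cases "F = {}")
    case False
    then have "Max (I ` F) \<in> I ` F" using F(1) by simp
    then obtain z where "z \<in> F" "I z = Max (I ` F)" by auto
    then have z: "z \<in> F" "\<And>y. y \<in> F \<Longrightarrow> I y \<le> I z" using F(1) by simp_all
    have "I y \<le> G k z" if "y \<in> F" "k \<in> S" for y k
    proof -
      have "I z \<le> G k z" unfolding I_def using bdd[of z] z(1) F(2) that by (intro cINF_lower) auto
      then show ?thesis using z(2)[OF that(1)] by simp
    qed
    then have "z \<in> X \<inter> (\<Inter>y\<in>F. C y)" using z(1) F(2) in_C[of z] by blast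
    then show ?thesis by blast
  qed (use X in auto)
  ultimately have "X \<inter> (\<Inter>y\<in>X. C y) \<noteq> {}"
    using compact_imp_fip_image[OF X(1), of X C] by blast
  then obtain x where x: "x \<in> X" "\<And>y. y \<in> X \<Longrightarrow> x \<in> C y" by blast
  have "I y \<le> I x" if "y \<in> X" for y
    using x(2)[OF that] S unfolding I_def[of x] in_C[OF x(1)] by (intro cINF_greatest) auto
  then show ?thesis using that x(1) unfolding I_def by blast
qed

section \<open>Mean values and Fourier coefficients\<close>

lemma exp_i_eq_cis: "exp (\<i> * complex_of_real y) = cis y"
  by (simp add: cis_conv_exp)

lemma fourier_coeff_cis: "fourier_coeff f \<mu> = mean_value (\<lambda>x. f x * cis (- \<mu> * x))"
proof -
  have "exp (- \<i> * complex_of_real (\<mu> * x)) = cis (- \<mu> * x)" for x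
    using exp_i_eq_cis[of "- \<mu> * x"] by simp
  then show ?thesis unfolding fourier_coeff_def by simp
qed

definition has_mean :: "(real \<Rightarrow> complex) \<Rightarrow> complex \<Rightarrow> bool" where
  "has_mean f L \<longleftrightarrow> ((\<lambda>T. complex_of_real (1 / T) * (LINT x:{0..T}|lebesgue. f x)) \<longlongrightarrow> L) at_top"

lemma has_mean_imp_mean_value: "has_mean f L \<Longrightarrow> mean_value f = L"
  unfolding has_mean_def mean_value_def by (rule tendsto_Lim[OF trivial_limit_at_top_linorder])

lemma has_mean_diff:
  assumes "\<And>T. set_integrable lebesgue {0..T} f" "\<And>T. set_integrable lebesgue {0..T} g"
    and "has_mean f L" "has_mean g L'"
  shows "has_mean (\<lambda>x. f x - g x) (L - L')"
  using tendsto_diff[OF assms(3,4)[unfolded has_mean_def]] assms(1,2)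
  unfolding has_mean_def by (simp add: set_integral_diff right_diff_distrib)

lemma integral_cis:
  assumes "\<nu> \<noteq> 0" "T \<ge> 0"
  shows "integral {0..T} (\<lambda>x. cis (\<nu> * x)) = (cis (\<nu> * T) - 1) / (\<i> * complex_of_real \<nu>)"
proof -
  let ?F = "\<lambda>z. exp (\<i> * complex_of_real \<nu> * z) / (\<i> * complex_of_real \<nu>)"
  have "((\<lambda>x. ?F (complex_of_real x)) has_vector_derivative cis (\<nu> * x)) (at x within {0..T})" for x
  proof (rule has_vector_derivative_real_field)
    show "(?F has_field_derivative cis (\<nu> * x)) (at (complex_of_real x))"
      using assms(1) by (auto intro!: derivative_eq_intros simp: cis_conv_exp mult.assoc)
  qed
  then have "((\<lambda>x. cis (\<nu> * x)) has_integral (?F (complex_of_real T) - ?F (complex_of_real 0))) {0..T}"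
    using assms(2) by (intro fundamental_theorem_of_calculus)
  moreover have "?F (complex_of_real T) - ?F (complex_of_real 0) = (cis (\<nu> * T) - 1) / (\<i> * complex_of_real \<nu>)"
    by (simp add: cis_conv_exp diff_divide_distrib mult.assoc)
  ultimately show ?thesis by (metis integral_unique)
qed

text \<open>Orthogonality of the characters: for \<open>\<nu> \<noteq> 0\<close> the integral of \<open>cis (\<nu> * x)\<close> stays bounded while the length of
  the interval grows.\<close>

lemma mean_cis_tendsto:
  "((\<lambda>T. complex_of_real (1 / T) * integral {0..T} (\<lambda>x. cis (\<nu> * x)))
     \<longlongrightarrow> (if \<nu> = 0 then 1 else 0)) at_top"
proof (cases "\<nu> = 0")
  case True
  have "\<forall>\<^sub>F T::real in at_top. complex_of_real (1 / T) * integral {0..T} (\<lambda>x. cis (\<nu> * x)) = 1"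
    using eventually_gt_at_top[of 0] by eventually_elim (simp add: True scaleR_conv_of_real)
  then show ?thesis using True by (simp add: tendsto_eventually)
next
  case False
  have "\<forall>\<^sub>F T in at_top. norm (complex_of_real (1 / T) * integral {0..T} (\<lambda>x. cis (\<nu> * x))) \<le> 2 / \<bar>\<nu>\<bar> / T"
    using eventually_gt_at_top[of 0]
  proof eventually_elim
    case (elim T)
    have "norm (cis (\<nu> * T) - 1) \<le> 2"
      using norm_triangle_ineq4[of "cis (\<nu> * T)" 1] by simp
    then have "norm (cis (\<nu> * T) - 1) / (\<bar>\<nu>\<bar> * T) \<le> 2 / (\<bar>\<nu>\<bar> * T)"
      using elim by (intro divide_right_mono) auto
    moreover have "norm (complex_of_real (1 / T) * integral {0..T} (\<lambda>x. cis (\<nu> * x)))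
        = norm (cis (\<nu> * T) - 1) / (\<bar>\<nu>\<bar> * T)"
      using elim unfolding integral_cis[OF False less_imp_le[OF elim]]
      by (simp add: norm_mult norm_divide)
    ultimately show ?case by simp
  qed
  moreover have "((\<lambda>T. 2 / \<bar>\<nu>\<bar> / T) \<longlongrightarrow> 0) at_top"
    by (intro tendsto_divide_0[OF tendsto_const] filterlim_at_top_imp_at_infinity filterlim_ident)
  ultimately show ?thesis using False by (simp add: Lim_null_comparison)
qed

lemma has_mean_trig_sum:
  assumes "finite S"
  shows "has_mean (\<lambda>x. \<Sum>i\<in>S. a i * cis (w i * x)) (\<Sum>i\<in>S. if w i = 0 then a i else 0)"
proof -
  have cont: "continuous_on A (\<lambda>x. cis (r * x))" for A r
    by (intro continuous_intros)
  have "(LINT x:{0..T}|lebesgue. \<Sum>i\<in>S. a i * cis (w i * x))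
      = (\<Sum>i\<in>S. a i * integral {0..T} (\<lambda>x. cis (w i * x)))" for T
  proof -
    have "(LINT x:{0..T}|lebesgue. \<Sum>i\<in>S. a i * cis (w i * x))
        = integral {0..T} (\<lambda>x. \<Sum>i\<in>S. a i * cis (w i * x))"
      by (intro set_lebesgue_integral_eq_integral(2) absolutely_integrable_continuous_real
          continuous_on_sum continuous_on_mult continuous_on_const cont)
    also have "\<dots> = (\<Sum>i\<in>S. integral {0..T} (\<lambda>x. a i * cis (w i * x)))"
      by (intro integral_sum assms integrable_continuous_real continuous_on_mult continuous_on_const cont)
    finally show ?thesis by (simp add: integral_mult_right)
  qed
  then have "complex_of_real (1 / T) * (LINT x:{0..T}|lebesgue. \<Sum>i\<in>S. a i * cis (w i * x))
      = (\<Sum>i\<in>S. a i * (complex_of_real (1 / T) * integral {0..T} (\<lambda>x. cis (w i * x))))" for T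
    by (simp add: sum_distrib_left mult.left_commute)
  moreover have "((\<lambda>T. \<Sum>i\<in>S. a i * (complex_of_real (1 / T) * integral {0..T} (\<lambda>x. cis (w i * x))))
      \<longlongrightarrow> (\<Sum>i\<in>S. a i * (if w i = 0 then 1 else 0))) at_top"
    by (intro tendsto_sum tendsto_mult tendsto_const mean_cis_tendsto)
  moreover have "(\<Sum>i\<in>S. a i * (if w i = 0 then 1 else 0)) = (\<Sum>i\<in>S. if w i = 0 then a i else 0)"
    by (intro sum.cong) auto
  ultimately show ?thesis unfolding has_mean_def by simp
qed

lemma set_integrable_mult_cis:
  assumes "set_integrable lebesgue A f"
  shows "set_integrable lebesgue A (\<lambda>x. f x * cis (\<nu> * x))"
  unfolding set_integrable_def
proof (rule Bochner_Integration.integrable_bound)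
  show "integrable lebesgue (\<lambda>x. indicator A x *\<^sub>R f x)" using assms unfolding set_integrable_def .
  have "(\<lambda>x. cis (\<nu> * x)) \<in> borel_measurable lborel"
    by (simp, intro borel_measurable_continuous_onI continuous_intros)
  then have "(\<lambda>x. cis (\<nu> * x)) \<in> borel_measurable lebesgue" by (rule measurable_completion)
  then have "(\<lambda>x. (indicator A x *\<^sub>R f x) * cis (\<nu> * x)) \<in> borel_measurable lebesgue"
    using borel_measurable_integrable[OF assms[unfolded set_integrable_def]]
    by (intro borel_measurable_times)
  then show "(\<lambda>x. indicator A x *\<^sub>R (f x * cis (\<nu> * x))) \<in> borel_measurable lebesgue" by simp
qed (simp add: norm_mult)

text \<open>Cauchy's criterion along a filter: two approximate limits for tolerances \<open>d\<close> and \<open>e\<close> are within \<open>d + e\<close>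
  of each other, because both are approached at a common point.\<close>

lemma tendsto_if_approx_limits:
  fixes F :: "'b \<Rightarrow> 'a::complete_space"
  assumes A: "A \<noteq> bot" and near: "\<And>e. e > 0 \<Longrightarrow> \<exists>L. \<forall>\<^sub>F x in A. dist (F x) L < e"
  shows "\<exists>L. (F \<longlongrightarrow> L) A"
proof -
  have "\<forall>n. \<exists>L. \<forall>\<^sub>F x in A. dist (F x) L < 1 / real (Suc n)"
    using near by simp
  then obtain L where L: "\<And>n. \<forall>\<^sub>F x in A. dist (F x) (L n) < 1 / real (Suc n)" by metis
  have dL: "dist (L m) (L n) < 1 / real (Suc m) + 1 / real (Suc n)" for m n
  proof -
    obtain x where "dist (F x) (L m) < 1 / real (Suc m)" "dist (F x) (L n) < 1 / real (Suc n)"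
      using eventually_happens'[OF A eventually_conj[OF L[of m] L[of n]]] by blast
    then show ?thesis using dist_triangle3[of "L m" "L n" "F x"] by linarith
  qed
  have small: "\<exists>N. \<forall>n\<ge>N. 1 / real (Suc n) < e" if e: "e > 0" for e
  proof -
    obtain N where N: "1 / real (Suc N) < e" using nat_approx_posE[OF e] by blast
    have "1 / real (Suc n) \<le> 1 / real (Suc N)" if "n \<ge> N" for n
      using that by (intro divide_left_mono) auto
    then show ?thesis using N by (meson order.strict_trans1)
  qed
  have "Cauchy L"
  proof (rule metric_CauchyI)
    fix e :: real assume "e > 0"
    then obtain N where N: "\<And>n. n \<ge> N \<Longrightarrow> 1 / real (Suc n) < e / 2" using small[of "e / 2"] by auto
    have "dist (L m) (L n) < e" if "m \<ge> N" "n \<ge> N" for m n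
      using dL[of m n] N[OF that(1)] N[OF that(2)] by linarith
    then show "\<exists>M. \<forall>m\<ge>M. \<forall>n\<ge>M. dist (L m) (L n) < e" by blast
  qed
  then obtain l where l: "L \<longlonglongrightarrow> l" using Cauchy_convergent_iff convergent_def by blast
  have "(F \<longlongrightarrow> l) A"
  proof (rule tendstoI)
    fix e :: real assume e: "e > 0"
    then obtain N where N: "\<And>n. n \<ge> N \<Longrightarrow> 1 / real (Suc n) < e / 2" using small[of "e / 2"] by auto
    obtain M where M: "\<And>n. n \<ge> M \<Longrightarrow> dist (L n) l < e / 2"
      using metric_LIMSEQ_D[OF l, of "e / 2"] e by auto
    show "\<forall>\<^sub>F x in A. dist (F x) l < e"
      using L[of "max M N"]
    proof eventually_elim
      case (elim x)
      then show ?case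
        using N[of "max M N"] M[of "max M N"] dist_triangle[of "F x" l "L (max M N)"] by linarith
    qed
  qed
  then show ?thesis by blast
qed

lemma trig_sum_cisE:
  assumes "trig_sum p"
  obtains S a where "finite S" "p = (\<lambda>x. \<Sum>\<mu>\<in>S. a \<mu> * cis (\<mu> * x))"
  using assms unfolding trig_sum_def exp_i_eq_cis by blast

lemma trig_sum_set_integrable:
  assumes "trig_sum p"
  shows "set_integrable lebesgue {a..b} p"
proof -
  obtain S c where "finite S" "p = (\<lambda>x. \<Sum>\<mu>\<in>S. c \<mu> * cis (\<mu> * x))" using trig_sum_cisE[OF assms] .
  then show ?thesis
    by (auto intro!: absolutely_integrable_continuous_real continuous_intros)
qed

text \<open>The factor 2 pays for the passage from the one-sided mean over \<open>{0..T}\<close>, which defines the Fourier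
  coefficients, to the symmetric mean over \<open>{-T..T}\<close>, which defines almost periodicity.\<close>

lemma mean_abs_bound:
  assumes f: "\<And>a b. set_integrable lebesgue {a..b} f" and T: "T > 0"
  shows "norm (complex_of_real (1 / T) * (LINT x:{0..T}|lebesgue. f x * cis (\<nu> * x)))
     \<le> 2 * (1 / (2 * T) * (LINT x:{-T..T}|lebesgue. cmod (f x)))"
proof -
  have "norm (LINT x:{0..T}|lebesgue. f x * cis (\<nu> * x)) \<le> (LINT x:{0..T}|lebesgue. norm (f x * cis (\<nu> * x)))"
    by (intro set_integral_norm_bound set_integrable_mult_cis f)
  also have "\<dots> = (LINT x:{0..T}|lebesgue. cmod (f x))" by (simp add: norm_mult)
  also have "\<dots> \<le> (LINT x:{-T..T}|lebesgue. cmod (f x))"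
    using T set_integrable_norm[OF f] unfolding set_lebesgue_integral_def set_integrable_def
    by (intro integral_mono) (auto simp: indicator_def)
  finally have "norm (LINT x:{0..T}|lebesgue. f x * cis (\<nu> * x)) / T \<le> (LINT x:{-T..T}|lebesgue. cmod (f x)) / T"
    using T by (intro divide_right_mono) auto
  then show ?thesis using T by (simp add: norm_divide)
qed

text \<open>The means of a trigonometric sum converge, and those of \<open>f\<close> stay eventually close to them. Existence
  of the limit matters because \<open>fourier_coeff\<close> is defined by a description operator and is linear only where the
  limits exist.\<close>

lemma B_ap_has_mean:
  assumes f: "B_ap f"
  shows "\<exists>L. has_mean (\<lambda>x. f x * cis (- \<mu> * x)) L"
  unfolding has_mean_def
proof (rule tendsto_if_approx_limits)
  fix e :: real assume e: "e > 0"
  have int: "\<And>a b. set_integrable lebesgue {a..b} f" using f unfolding B_ap_def by blast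
  obtain p where p: "\<And>N. trig_sum (p N)" "(\<lambda>N::nat. Limsup at_top
      (\<lambda>T. ereal (1 / (2 * T) * (LINT x:{-T..T}|lebesgue. cmod (f x - p N x))))) \<longlonglongrightarrow> 0"
    using f unfolding B_ap_def by blast
  have "\<forall>\<^sub>F N in sequentially. Limsup at_top
      (\<lambda>T. ereal (1 / (2 * T) * (LINT x:{-T..T}|lebesgue. cmod (f x - p N x)))) < ereal (e / 4)"
    using p(2) e by (intro order_tendstoD(2)) auto
  then obtain N where "Limsup at_top
      (\<lambda>T. ereal (1 / (2 * T) * (LINT x:{-T..T}|lebesgue. cmod (f x - p N x)))) < ereal (e / 4)"
    using eventually_happens'[OF sequentially_bot] by blast
  from Limsup_lessD[OF this] have close: "\<forall>\<^sub>F T in at_top.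
      1 / (2 * T) * (LINT x:{-T..T}|lebesgue. cmod (f x - p N x)) < e / 4" by simp
  obtain S a where S: "finite S" and pN: "p N = (\<lambda>x. \<Sum>\<nu>\<in>S. a \<nu> * cis (\<nu> * x))"
    using trig_sum_cisE[OF p(1)] .
  have pcis: "p N x * cis (- \<mu> * x) = (\<Sum>\<nu>\<in>S. a \<nu> * cis ((\<nu> - \<mu>) * x))" for x
    unfolding pN sum_distrib_right mult.assoc cis_mult by (simp add: left_diff_distrib)
  \<comment> \<open>Multiplication by a character shifts the frequencies, so the mean picks out the coefficient at \<open>\<mu>\<close>.\<close>
  define L where "L = (\<Sum>\<nu>\<in>S. if \<nu> - \<mu> = 0 then a \<nu> else 0)"
  have "has_mean (\<lambda>x. p N x * cis (- \<mu> * x)) L"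
    unfolding pcis L_def by (rule has_mean_trig_sum[OF S])
  then have "\<forall>\<^sub>F T in at_top. dist (complex_of_real (1 / T) * (LINT x:{0..T}|lebesgue. p N x * cis (- \<mu> * x))) L < e / 2"
    unfolding has_mean_def using e by (intro tendstoD) auto
  then have "\<forall>\<^sub>F T in at_top. dist (complex_of_real (1 / T) * (LINT x:{0..T}|lebesgue. f x * cis (- \<mu> * x))) L < e"
    using close eventually_gt_at_top[of 0]
  proof eventually_elim
    case (elim T)
    have intp: "\<And>a b. set_integrable lebesgue {a..b} (p N)" using trig_sum_set_integrable[OF p(1)] .
    have "(LINT x:{0..T}|lebesgue. f x * cis (- \<mu> * x) - p N x * cis (- \<mu> * x))
        = (LINT x:{0..T}|lebesgue. f x * cis (- \<mu> * x)) - (LINT x:{0..T}|lebesgue. p N x * cis (- \<mu> * x))"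
      by (intro set_integral_diff(2) set_integrable_mult_cis int intp)
    then have "complex_of_real (1 / T) * (LINT x:{0..T}|lebesgue. f x * cis (- \<mu> * x))
        - complex_of_real (1 / T) * (LINT x:{0..T}|lebesgue. p N x * cis (- \<mu> * x))
        = complex_of_real (1 / T) * (LINT x:{0..T}|lebesgue. (f x - p N x) * cis (- \<mu> * x))"
      by (simp only: left_diff_distrib right_diff_distrib)
    moreover have "norm (complex_of_real (1 / T) * (LINT x:{0..T}|lebesgue. (f x - p N x) * cis (- \<mu> * x)))
        \<le> 2 * (1 / (2 * T) * (LINT x:{-T..T}|lebesgue. cmod (f x - p N x)))"
      using elim by (intro mean_abs_bound set_integral_diff int intp) auto
    ultimately have "dist (complex_of_real (1 / T) * (LINT x:{0..T}|lebesgue. f x * cis (- \<mu> * x)))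
        (complex_of_real (1 / T) * (LINT x:{0..T}|lebesgue. p N x * cis (- \<mu> * x))) < e / 2"
      using elim(2) unfolding dist_norm by simp
    then show ?case using elim(1) dist_triangle[of "complex_of_real (1 / T) * (LINT x:{0..T}|lebesgue. f x * cis (- \<mu> * x))" L
        "complex_of_real (1 / T) * (LINT x:{0..T}|lebesgue. p N x * cis (- \<mu> * x))"] by linarith
  qed
  then show "\<exists>L. \<forall>\<^sub>F T in at_top. dist (complex_of_real (1 / T) * (LINT x:{0..T}|lebesgue. f x * cis (- \<mu> * x))) L < e"
    by blast
qed simp

lemma fourier_coeff_diff:
  assumes "B_ap f" "B_ap g"
  shows "fourier_coeff (\<lambda>x. f x - g x) \<mu> = fourier_coeff f \<mu> - fourier_coeff g \<mu>"
proof -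
  obtain L where L: "has_mean (\<lambda>x. f x * cis (- \<mu> * x)) L" using B_ap_has_mean[OF assms(1)] by blast
  obtain L' where L': "has_mean (\<lambda>x. g x * cis (- \<mu> * x)) L'" using B_ap_has_mean[OF assms(2)] by blast
  have int: "\<And>a b. set_integrable lebesgue {a..b} f" "\<And>a b. set_integrable lebesgue {a..b} g"
    using assms unfolding B_ap_def by blast+
  have "has_mean (\<lambda>x. f x * cis (- \<mu> * x) - g x * cis (- \<mu> * x)) (L - L')"
    by (intro has_mean_diff L L' set_integrable_mult_cis int)
  then have "has_mean (\<lambda>x. (f x - g x) * cis (- \<mu> * x)) (L - L')"
    by (simp only: left_diff_distrib)
  then show ?thesis
    unfolding fourier_coeff_cis has_mean_imp_mean_value[OF L] has_mean_imp_mean_value[OF L']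
    by (rule has_mean_imp_mean_value)
qed

lemma fourier_coeff_trig_sum:
  assumes "finite F"
  shows "fourier_coeff (\<lambda>x. \<Sum>k\<in>F. a k * cis (w k * x)) \<mu> = (\<Sum>k\<in>F. if w k = \<mu> then a k else 0)"
proof -
  have eq: "(\<Sum>k\<in>F. a k * cis (w k * x)) * cis (- \<mu> * x) = (\<Sum>k\<in>F. a k * cis ((w k - \<mu>) * x))" for x
    unfolding sum_distrib_right mult.assoc cis_mult by (simp add: left_diff_distrib)
  show ?thesis
    unfolding fourier_coeff_cis eq has_mean_imp_mean_value[OF has_mean_trig_sum[OF assms]]
    by simp
qed

lemma B_ap_trig_sum:
  assumes "finite F" "inj_on w F"
  shows "B_ap (\<lambda>x. \<Sum>k\<in>F. a k * cis (w k * x))"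
proof -
  let ?p = "\<lambda>x. \<Sum>k\<in>F. a k * cis (w k * x)"
  have "?p = (\<lambda>x. \<Sum>\<mu>\<in>w ` F. a (inv_into F w \<mu>) * exp (\<i> * complex_of_real (\<mu> * x)))"
  proof
    fix x
    show "?p x = (\<Sum>\<mu>\<in>w ` F. a (inv_into F w \<mu>) * exp (\<i> * complex_of_real (\<mu> * x)))"
      unfolding exp_i_eq_cis sum.reindex[OF assms(2)]
      by (rule sum.cong) (use assms(2) in auto)
  qed
  then have p: "trig_sum ?p" unfolding trig_sum_def
    by (intro exI[of _ "w ` F"] exI[of _ "\<lambda>\<mu>. a (inv_into F w \<mu>)"] conjI finite_imageI assms(1))
  show ?thesis unfolding B_ap_def
  proof (intro conjI allI exI[of _ "\<lambda>_. ?p"])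
    show "(\<lambda>N::nat. Limsup at_top (\<lambda>T. ereal (1 / (2 * T) * (LINT x:{-T..T}|lebesgue. cmod (?p x - ?p x)))))
      \<longlonglongrightarrow> 0"
      by (simp add: set_lebesgue_integral_def Limsup_const zero_ereal_def[symmetric])
  qed (use p trig_sum_set_integrable[OF p] in auto)
qed

section \<open>The multipliers and the modulus of smoothness\<close>

lemma exponent_seq_strict_mono:
  assumes "exponent_seq \<Lambda>"
  shows "strict_mono \<Lambda>"
proof (rule strict_monoI)
  have odd: "\<Lambda> (- k) = - \<Lambda> k" for k using assms by (simp add: exponent_seq_def)
  have up: "\<Lambda> k < \<Lambda> (k + 1)" if "k \<ge> 0" for k
  proof (cases "k = 0")
    case True
    have "\<Lambda> 0 = 0" "0 < \<Lambda> 1" using assms by (auto simp: exponent_seq_def)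
    then show ?thesis using True by simp
  next
    case False
    then have "1 \<le> k" using that by simp
    then show ?thesis using assms by (simp add: exponent_seq_def)
  qed
  have step: "\<Lambda> k < \<Lambda> (k + 1)" for k
  proof (cases "k \<ge> 0")
    case False
    then show ?thesis using up[of "- k - 1"] odd[of k] odd[of "k + 1"] by simp
  qed (rule up)
  have far: "\<Lambda> k < \<Lambda> (k + 1 + int m)" for k m
  proof (induction m)
    case (Suc m)
    then show ?case using step[of "k + 1 + int m"] by (simp add: algebra_simps)
  qed (simp add: step)
  fix j k :: int assume "j < k"
  then show "\<Lambda> j < \<Lambda> k" using far[of j "nat (k - j - 1)"] by simp
qed

lemma ereal_infsum_le:
  fixes f :: "'a \<Rightarrow> ereal"
  assumes "\<And>k. 0 \<le> f k" "\<And>F. finite F \<Longrightarrow> sum f F \<le> c"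
  shows "(\<Sum>\<^sub>\<infinity>k\<in>UNIV. f k) \<le> c"
  using assms by (subst nonneg_infsum_complete) (auto intro: SUP_least)

lemma ereal_sum_le_infsum:
  fixes f :: "'a \<Rightarrow> ereal"
  assumes "\<And>k. 0 \<le> f k" "finite F"
  shows "sum f F \<le> (\<Sum>\<^sub>\<infinity>k\<in>UNIV. f k)"
  using assms by (subst nonneg_infsum_complete) (auto intro: SUP_upper)

lemma conjugate_fun_nonneg:
  assumes "orlicz_fun m"
  shows "0 \<le> conjugate_fun m v"
proof -
  have "ereal (0 * v - m 0) \<le> conjugate_fun m v"
    unfolding conjugate_fun_def by (rule SUP_upper) simp
  then show ?thesis using assms by (simp add: orlicz_fun_def zero_ereal_def)
qed

text \<open>An Orlicz function grows at least linearly: once \<open>m u0 \<ge> 1\<close>, convexity and \<open>m 0 = 0\<close> give \<open>m u \<ge> u / u0\<close>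
  for \<open>u \<ge> u0\<close>. For \<open>v \<le> 1 / u0\<close> only arguments below \<open>u0\<close> contribute to the conjugate, and these contribute
  at most \<open>u0 * v\<close>.\<close>

lemma conjugate_fun_small:
  assumes m: "orlicz_fun m" and e: "e > 0"
  obtains v where "v > 0" "conjugate_fun m v \<le> ereal e"
proof -
  have m0: "\<And>t. t \<ge> 0 \<Longrightarrow> 0 \<le> m t" "m 0 = 0" and conv: "convex_on {0..} m"
    using m by (auto simp: orlicz_fun_def)
  have "eventually (\<lambda>t. m t \<ge> 1) at_top"
    using m unfolding orlicz_fun_def filterlim_at_top by blast
  then obtain u0 where u0: "u0 > 0" "m u0 \<ge> 1"
    using eventually_happens'[OF _ eventually_conj[OF eventually_gt_at_top[of "0::real"]]] by force
  have lin: "u / u0 \<le> m u" if "u \<ge> u0" for u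
  proof -
    have "m ((1 - u0 / u) *\<^sub>R 0 + (u0 / u) *\<^sub>R u) \<le> (1 - u0 / u) * m 0 + (u0 / u) * m u"
      using that u0 by (intro convex_onD[OF conv]) auto
    then have "m u0 \<le> u0 / u * m u" using that u0 m0 by simp
    then have "1 \<le> u0 / u * m u" using u0 by linarith
    then show ?thesis using that u0 by (simp add: field_simps)
  qed
  define v where "v = min 1 e / u0"
  have v: "v > 0" "v \<le> 1 / u0" "v \<le> e / u0"
    using u0 e by (auto simp: v_def intro!: divide_right_mono)
  have "u * v - m u \<le> e" if "u \<ge> 0" for u
  proof (cases "u \<ge> u0")
    case True
    have "u * v \<le> u * (1 / u0)" using v that by (intro mult_left_mono) auto
    then show ?thesis using lin[OF True] e by simp
  next
    case False
    have "u * v \<le> u0 * (e / u0)" using v that False u0 e by (intro mult_mono) auto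
    then show ?thesis using m0(1)[OF that] u0 by simp
  qed
  then have "conjugate_fun m v \<le> ereal e"
    unfolding conjugate_fun_def by (intro SUP_least) simp
  then show ?thesis using that v by blast
qed

text \<open>Without an element of \<open>Gamma_set M\<close> the norms and moduli would be suprema of the empty set, that is,
  \<open>- \<infinity>\<close>. Values \<open>\<gamma> k\<close> are chosen so small that the conjugates are dominated by a rearranged geometric series.\<close>

lemma Gamma_set_nonempty:
  assumes M: "\<And>k. orlicz_fun (M k)"
  shows "Gamma_set M \<noteq> {}"
proof -
  define e :: "int \<Rightarrow> real" where "e k = (1 / 2) ^ Suc (to_nat k)" for k
  have "\<exists>v. v > 0 \<and> conjugate_fun (M k) v \<le> ereal (e k)" for k
  proof -
    have "e k > 0" by (simp add: e_def)
    from conjugate_fun_small[OF M this] show ?thesis by blast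
  qed
  then obtain \<gamma> where \<gamma>: "\<And>k. \<gamma> k > 0" "\<And>k. conjugate_fun (M k) (\<gamma> k) \<le> ereal (e k)" by metis
  have "(\<Sum>\<^sub>\<infinity>k\<in>UNIV. conjugate_fun (M k) (\<gamma> k)) \<le> 1"
  proof (rule ereal_infsum_le)
    fix F :: "int set" assume F: "finite F"
    have "(\<Sum>k\<in>F. conjugate_fun (M k) (\<gamma> k)) \<le> (\<Sum>k\<in>F. ereal (e k))"
      by (intro sum_mono \<gamma>)
    also have "(\<Sum>k\<in>F. e k) = (\<Sum>i\<in>to_nat ` F. (1 / 2) ^ Suc i)"
      by (simp add: sum.reindex e_def)
    then have "(\<Sum>k\<in>F. ereal (e k)) = ereal (\<Sum>i\<in>to_nat ` F. (1 / 2) ^ Suc i)"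
      by simp
    also have "(\<Sum>i\<in>to_nat ` F. (1 / 2 :: real) ^ Suc i) \<le> 1"
      using sum_le_suminf[OF sums_summable[OF power_half_series], of "to_nat ` F"] F
        sums_unique[OF power_half_series] by simp
    finally show "(\<Sum>k\<in>F. conjugate_fun (M k) (\<gamma> k)) \<le> 1" by (simp add: one_ereal_def)
  qed (rule conjugate_fun_nonneg[OF M])
  then show ?thesis using \<gamma>(1) unfolding Gamma_set_def by blast
qed

lemma gen_modulus_upper:
  assumes \<phi>: "\<phi> \<in> Phi_set" and "\<bar>h\<bar> \<le> \<delta>" "\<gamma> \<in> Gamma_set M" "finite F"
  shows "ereal (\<Sum>k\<in>F. \<gamma> k * \<phi> (\<Lambda> k * h) * cmod (fourier_coeff f (\<Lambda> k))) \<le> gen_modulus M \<Lambda> \<phi> f \<delta>"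
proof -
  have "ereal (\<Sum>k\<in>F. \<gamma> k * \<phi> (\<Lambda> k * h) * cmod (fourier_coeff f (\<Lambda> k)))
      = (\<Sum>k\<in>F. ereal (\<gamma> k * \<phi> (\<Lambda> k * h) * cmod (fourier_coeff f (\<Lambda> k))))" by simp
  also have "\<dots> \<le> (\<Sum>\<^sub>\<infinity>k\<in>UNIV. ereal (\<gamma> k * \<phi> (\<Lambda> k * h) * cmod (fourier_coeff f (\<Lambda> k))))"
    using assms by (intro ereal_sum_le_infsum) (auto simp: Gamma_set_def Phi_set_def less_imp_le)
  also have "\<dots> \<le> gen_modulus M \<Lambda> \<phi> f \<delta>"
    unfolding gen_modulus_def using assms by (intro SUP_upper2[of h] SUP_upper) auto
  finally show ?thesis .
qed

text \<open>This is where the nonvanishing of the coefficients enters. In extended real arithmetic \<open>\<infinity> * 0 = 0\<close>,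
  so the inequality of the theorem is trivial for an infinite constant only if the modulus is positive.
  The zeros of \<open>\<phi>\<close> form a null set, hence do not fill the interval that \<open>\<Lambda> 1 * h\<close> runs through, and a
  nonzero coefficient at \<open>\<Lambda> 1\<close> or \<open>\<Lambda> (- 1)\<close> gives a positive term.\<close>

lemma gen_modulus_pos:
  assumes \<Lambda>: "exponent_seq \<Lambda>" and M: "\<And>k. orlicz_fun (M k)" and F: "form_F \<Lambda> f"
    and \<phi>: "\<phi> \<in> Phi_set" and \<delta>: "\<delta> > 0"
  shows "gen_modulus M \<Lambda> \<phi> f \<delta> > 0"
proof -
  obtain \<gamma> where \<gamma>: "\<gamma> \<in> Gamma_set M" using Gamma_set_nonempty[of M, OF M] by blast
  have \<Lambda>1: "\<Lambda> 1 > 0" "\<Lambda> (- 1) = - \<Lambda> 1" using \<Lambda> by (auto simp: exponent_seq_def)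
  have "cmod (fourier_coeff f (\<Lambda> 1)) + cmod (fourier_coeff f (\<Lambda> (- 1))) > 0"
    using F by (simp add: form_F_def)
  then have "fourier_coeff f (\<Lambda> 1) \<noteq> 0 \<or> fourier_coeff f (\<Lambda> (- 1)) \<noteq> 0" by auto
  then obtain k :: int where k: "k = 1 \<or> k = - 1" "fourier_coeff f (\<Lambda> k) \<noteq> 0" by blast
  have "\<not> {0..\<Lambda> 1 * \<delta>} \<subseteq> {t. \<phi> t = 0}"
  proof
    assume "{0..\<Lambda> 1 * \<delta>} \<subseteq> {t. \<phi> t = 0}"
    then have "{0..\<Lambda> 1 * \<delta>} \<in> null_sets lebesgue"
      using \<phi> null_sets_subset[of "{t. \<phi> t = 0}" lebesgue "{0..\<Lambda> 1 * \<delta>}"] by (simp add: Phi_set_def)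
    then have "emeasure lebesgue {0..\<Lambda> 1 * \<delta>} = 0" by (rule null_setsD1)
    moreover have "emeasure lebesgue {0..\<Lambda> 1 * \<delta>} = ennreal (\<Lambda> 1 * \<delta>)"
      using \<Lambda>1 \<delta> by simp
    ultimately show False using \<Lambda>1 \<delta> by (simp add: ennreal_eq_0_iff mult_le_0_iff)
  qed
  then obtain t where "t \<in> {0..\<Lambda> 1 * \<delta>}" "t \<notin> {t. \<phi> t = 0}" by blast
  then have t: "0 \<le> t" "t \<le> \<Lambda> 1 * \<delta>" "\<phi> t \<noteq> 0" by auto
  define h where "h = t / \<Lambda> 1"
  have h: "\<bar>h\<bar> \<le> \<delta>" using t \<Lambda>1 by (simp add: h_def field_simps)
  have "\<Lambda> k * h = t \<or> \<Lambda> k * h = - t" using k(1) \<Lambda>1 by (auto simp: h_def)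
  then have "\<phi> (\<Lambda> k * h) > 0" using t(3) \<phi> unfolding Phi_set_def
    by (auto simp: order_less_le)
  moreover have "\<gamma> k > 0" using \<gamma> by (simp add: Gamma_set_def)
  ultimately have "0 < ereal (\<Sum>k\<in>{k}. \<gamma> k * \<phi> (\<Lambda> k * h) * cmod (fourier_coeff f (\<Lambda> k)))"
    using k(2) by (simp add: zero_ereal_def[symmetric] mult_pos_pos)
  also have "\<dots> \<le> gen_modulus M \<Lambda> \<phi> f \<delta>" by (rule gen_modulus_upper[OF \<phi> h \<gamma>]) simp
  finally show ?thesis .
qed

section \<open>The extremal weight\<close>

lemma V_set_increment_pos:
  assumes "v \<in> V_set \<tau>" "\<tau> > 0"
  shows "v 0 < v \<tau>"
proof (rule ccontr)
  assume "\<not> v 0 < v \<tau>"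
  have mono: "mono_on {0..\<tau>} v" using assms by (simp add: V_set_def)
  have "v x = v 0" if "x \<in> {0..\<tau>}" for x
    using mono_onD[OF mono, of 0 x] mono_onD[OF mono, of x \<tau>] that \<open>\<not> v 0 < v \<tau>\<close> by auto
  then have "v constant_on {0..\<tau>}" unfolding constant_on_def by blast
  then show False using assms by (simp add: V_set_def)
qed

lemma continuous_on_dilated_Phi:
  assumes "\<phi> \<in> Phi_set"
  shows "continuous_on A (\<lambda>t. \<phi> (c * t / d))"
proof -
  have \<phi>: "continuous_on UNIV \<phi>" using assms by (simp add: Phi_set_def)
  have "continuous_on A (\<lambda>t. c * t / d)" by (simp add: divide_inverse continuous_intros)
  then show ?thesis by (rule continuous_on_compose2[OF \<phi>]) simp
qed

lemma RS_integral_dilated_Phi_nonneg: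
  assumes "\<phi> \<in> Phi_set" "\<tau> \<ge> 0" "mono_on {0..\<tau>} v"
  shows "0 \<le> RS_integral (\<lambda>t. \<phi> (c * t / d)) v 0 \<tau>"
proof -
  have "RS_integral (\<lambda>t. 0) v 0 \<tau> \<le> RS_integral (\<lambda>t. \<phi> (c * t / d)) v 0 \<tau>"
    using assms by (intro RS_integral_mono continuous_on_const continuous_on_dilated_Phi)
      (auto simp: Phi_set_def)
  then show ?thesis using RS_integral_const[OF assms(2,3), of 0] by simp
qed

lemma I_const_lower:
  assumes "\<phi> \<in> Phi_set" "\<tau> \<ge> 0" "mono_on {0..\<tau>} v" "n \<le> k"
  shows "I_const \<Lambda> n \<phi> \<tau> v \<le> RS_integral (\<lambda>t. \<phi> (\<Lambda> (int k) * t / \<Lambda> (int n))) v 0 \<tau>"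
  unfolding I_const_def using assms
  by (intro cINF_lower bdd_belowI[of _ 0]) (auto intro: RS_integral_dilated_Phi_nonneg)

lemma I_const_nonneg:
  assumes "\<phi> \<in> Phi_set" "\<tau> \<ge> 0" "mono_on {0..\<tau>} v"
  shows "0 \<le> I_const \<Lambda> n \<phi> \<tau> v"
  unfolding I_const_def using assms
  by (intro cINF_greatest) (auto intro: RS_integral_dilated_Phi_nonneg)

lemma cumulative_dist_subset_V_set:
  assumes "\<tau> > 0"
  shows "cumulative_dist \<tau> \<subseteq> V_set \<tau>"
proof
  fix v assume v: "v \<in> cumulative_dist \<tau>"
  have "v ` {0..\<tau>} \<subseteq> {0..1}" using v by (auto simp: cumulative_dist_def)
  then have "bounded (v ` {0..\<tau>})" using bounded_subset bounded_closed_interval by blast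
  moreover have "\<not> v constant_on {0..\<tau>}"
  proof
    assume "v constant_on {0..\<tau>}"
    then have "v 0 = v \<tau>" using assms unfolding constant_on_def by force
    then show False using v by (auto simp add: cumulative_dist_def)
  qed
  ultimately show "v \<in> V_set \<tau>" using v by (simp add: V_set_def cumulative_dist_def)
qed

lemma cumulative_dist_nonempty:
  assumes "\<tau> > 0"
  shows "cumulative_dist \<tau> \<noteq> {}"
proof -
  have "(\<lambda>x. if x < \<tau> then 0 else 1) \<in> cumulative_dist \<tau>"
    using assms by (auto simp: cumulative_dist_def mono_on_def)
  then show ?thesis by blast
qed

text \<open>A weight divided by its total increment. The argument is clamped to \<open>{0..\<tau>}\<close> because nothing is known
  about \<open>v\<close> outside this interval.\<close>

lemma normalise_V_set:
  assumes \<tau>: "\<tau> > 0" and v: "v \<in> V_set \<tau>"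
  obtains u where "u \<in> cumulative_dist \<tau>"
    "\<And>g. continuous_on {0..\<tau>} g \<Longrightarrow> RS_integral g u 0 \<tau> = RS_integral g v 0 \<tau> / (v \<tau> - v 0)"
proof -
  define u where "u x = (v (max 0 (min \<tau> x)) - v 0) / (v \<tau> - v 0)" for x
  have c: "v \<tau> - v 0 > 0" using V_set_increment_pos[OF v \<tau>] by simp
  have mono: "mono_on {0..\<tau>} v" using v by (simp add: V_set_def)
  have "u x \<in> {0..1}" for x
    using mono_onD[OF mono, of 0 "max 0 (min \<tau> x)"] mono_onD[OF mono, of "max 0 (min \<tau> x)" \<tau>] \<tau> c
    by (auto simp: u_def)
  moreover have u_mono: "mono_on {0..\<tau>} u"
    using mono c by (auto simp: u_def mono_on_def intro!: divide_right_mono)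
  moreover have "u 0 = 0" "u \<tau> = 1" using \<tau> c by (auto simp: u_def)
  ultimately have u: "u \<in> cumulative_dist \<tau>" by (simp add: cumulative_dist_def)
  have "RS_integral g u 0 \<tau> = RS_integral g v 0 \<tau> / (v \<tau> - v 0)" if g: "continuous_on {0..\<tau>} g" for g
  proof -
    have "uniform_RS_sum g u 0 \<tau> N = uniform_RS_sum g v 0 \<tau> N / (v \<tau> - v 0)" for N
    proof -
      have ux: "u (0 + real i * ((\<tau> - 0) / real N)) = (v (0 + real i * ((\<tau> - 0) / real N)) - v 0) / (v \<tau> - v 0)"
        if "i \<le> N" for i
      proof -
        have "real i * (\<tau> / real N) \<le> \<tau>" using that \<tau> by (cases "N = 0") (auto simp: field_simps)
        then show ?thesis using \<tau> by (simp add: u_def)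
      qed
      show ?thesis unfolding uniform_RS_sum_def Let_def sum_divide_distrib
        by (intro sum.cong refl) (simp only: ux Suc_leI less_imp_le lessThan_iff diff_divide_distrib[symmetric], simp)
    qed
    moreover have "(\<lambda>N. uniform_RS_sum g v 0 \<tau> N / (v \<tau> - v 0)) \<longlonglongrightarrow> RS_integral g v 0 \<tau> / (v \<tau> - v 0)"
      using \<tau> c by (intro tendsto_divide tendsto_const uniform_RS_sum_tendsto g mono) auto
    ultimately have "uniform_RS_sum g u 0 \<tau> \<longlonglongrightarrow> RS_integral g v 0 \<tau> / (v \<tau> - v 0)"
      by presburger
    moreover have "uniform_RS_sum g u 0 \<tau> \<longlonglongrightarrow> RS_integral g u 0 \<tau>"
      using \<tau> by (intro uniform_RS_sum_tendsto g u_mono) simp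
    ultimately show ?thesis by (metis LIMSEQ_unique)
  qed
  then show ?thesis using that u by blast
qed

lemma V_ratio_eq:
  assumes "v 0 < v \<tau>"
  shows "V_ratio \<Lambda> n \<phi> \<tau> v =
    (if I_const \<Lambda> n \<phi> \<tau> v = 0 then \<infinity> else ereal ((v \<tau> - v 0) / I_const \<Lambda> n \<phi> \<tau> v))"
  using assms unfolding V_ratio_def ereal_divide by simp

text \<open>The ratio does not change when a weight is normalised, so minimising it amounts to maximising
  \<open>I_const\<close> over the compact set of weights of total mass 1. There \<open>I_const\<close> is an infimum of continuous functions
  of the weight. If the maximum is 0, every ratio is \<open>\<infinity>\<close> and any weight is extremal.\<close>

lemma extremal_weight_exists:
  assumes \<phi>: "\<phi> \<in> Phi_set" and \<tau>: "\<tau> > 0"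
  shows "\<exists>v\<^sub>0\<in>V_set \<tau>. V_ratio \<Lambda> n \<phi> \<tau> v\<^sub>0 = K_const \<Lambda> n \<phi> \<tau>"
proof -
  let ?G = "\<lambda>k v. RS_integral (\<lambda>t. \<phi> (\<Lambda> (int k) * t / \<Lambda> (int n))) v 0 \<tau>"
  obtain v0 where v0: "v0 \<in> cumulative_dist \<tau>"
    and max: "\<And>u. u \<in> cumulative_dist \<tau> \<Longrightarrow> (INF k\<in>{n..}. ?G k u) \<le> (INF k\<in>{n..}. ?G k v0)"
  proof (rule compact_attains_sup_INF[of "cumulative_dist \<tau>" "{n..}" ?G])
    show "bdd_below ((\<lambda>k. ?G k v) ` {n..})" if "v \<in> cumulative_dist \<tau>" for v
      using that \<tau> RS_integral_dilated_Phi_nonneg[OF \<phi>]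
      by (intro bdd_belowI[of _ 0]) (auto simp: cumulative_dist_def)
    show "continuous_on (cumulative_dist \<tau>) (?G k)" for k
      using \<tau> by (intro continuous_on_RS_integral continuous_on_dilated_Phi \<phi>) simp
  qed (auto simp: compact_cumulative_dist cumulative_dist_nonempty[OF \<tau>])
  have mono0: "mono_on {0..\<tau>} v0" and inc0: "v0 \<tau> - v0 0 = 1" using v0 by (auto simp: cumulative_dist_def)
  have "V_ratio \<Lambda> n \<phi> \<tau> v0 \<le> V_ratio \<Lambda> n \<phi> \<tau> v" if v: "v \<in> V_set \<tau>" for v
  proof -
    have mono: "mono_on {0..\<tau>} v" using v by (simp add: V_set_def)
    define c where "c = v \<tau> - v 0"
    have c: "c > 0" using V_set_increment_pos[OF v \<tau>] by (simp add: c_def)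
    obtain u where u_dist: "u \<in> cumulative_dist \<tau>"
      and "\<And>g. continuous_on {0..\<tau>} g \<Longrightarrow> RS_integral g u 0 \<tau> = RS_integral g v 0 \<tau> / c"
      using normalise_V_set[OF \<tau> v] unfolding c_def by blast
    then have u: "?G k u = ?G k v / c" for k
      using continuous_on_dilated_Phi[OF \<phi>] by blast
    have "I_const \<Lambda> n \<phi> \<tau> v / c \<le> (INF k\<in>{n..}. ?G k u)"
      using c \<tau> unfolding u
      by (intro cINF_greatest divide_right_mono I_const_lower[OF \<phi> _ mono]) auto
    also have "\<dots> \<le> I_const \<Lambda> n \<phi> \<tau> v0" unfolding I_const_def by (rule max[OF u_dist])
    finally have le: "I_const \<Lambda> n \<phi> \<tau> v / c \<le> I_const \<Lambda> n \<phi> \<tau> v0" .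
    have nn: "0 \<le> I_const \<Lambda> n \<phi> \<tau> v" using I_const_nonneg[OF \<phi> _ mono] \<tau> by simp
    show ?thesis
    proof (cases "I_const \<Lambda> n \<phi> \<tau> v = 0")
      case True
      then show ?thesis using V_set_increment_pos[OF v \<tau>] by (simp add: V_ratio_eq)
    next
      case False
      then have pos: "I_const \<Lambda> n \<phi> \<tau> v > 0" using nn by simp
      then have "I_const \<Lambda> n \<phi> \<tau> v0 > 0" using le c by (smt (verit) divide_pos_pos)
      moreover from this have "1 / I_const \<Lambda> n \<phi> \<tau> v0 \<le> c / I_const \<Lambda> n \<phi> \<tau> v"
        using le c pos by (simp add: field_simps)
      ultimately show ?thesis using pos V_set_increment_pos[OF v \<tau>] inc0 by (simp add: V_ratio_eq c_def)
    qed
  qed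
  then have "V_ratio \<Lambda> n \<phi> \<tau> v0 = K_const \<Lambda> n \<phi> \<tau>"
    unfolding K_const_def using v0 cumulative_dist_subset_V_set[OF \<tau>]
    by (intro antisym INF_greatest INF_lower) auto
  then show ?thesis using v0 cumulative_dist_subset_V_set[OF \<tau>] by blast
qed

section \<open>The inequality for the best approximation\<close>

text \<open>The heart of the inequality: every frequency beyond \<open>n\<close> has \<open>\<phi>\<close>-mean at least \<open>I_const\<close> with respect to
  \<open>v\<close>, so integrating a pointwise bound for the \<open>\<phi>\<close>-weighted sum bounds the unweighted one. Negative
  frequencies are covered because \<open>\<phi>\<close> is even. For finite sums the exchange of sum and integral is plain
  linearity.\<close>

lemma I_const_times_tail_le:
  assumes \<Lambda>: "exponent_seq \<Lambda>" and \<phi>: "\<phi> \<in> Phi_set" and \<tau>: "\<tau> > 0" and v: "v \<in> V_set \<tau>"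
    and F: "finite F" "\<And>k. k \<in> F \<Longrightarrow> int n \<le> \<bar>k\<bar>" and c: "\<And>k. k \<in> F \<Longrightarrow> 0 \<le> c k"
    and w: "\<And>t. 0 \<le> t \<Longrightarrow> t \<le> \<tau> \<Longrightarrow> (\<Sum>k\<in>F. c k * \<phi> (\<Lambda> k * t / \<Lambda> (int n))) \<le> w"
  shows "I_const \<Lambda> n \<phi> \<tau> v * (\<Sum>k\<in>F. c k) \<le> w * (v \<tau> - v 0)"
proof -
  have mono: "mono_on {0..\<tau>} v" using v by (simp add: V_set_def)
  have I_le: "I_const \<Lambda> n \<phi> \<tau> v \<le> RS_integral (\<lambda>t. \<phi> (\<Lambda> k * t / \<Lambda> (int n))) v 0 \<tau>" if "k \<in> F" for k
  proof -
    have "\<phi> (\<Lambda> k * t / \<Lambda> (int n)) = \<phi> (\<Lambda> \<bar>k\<bar> * t / \<Lambda> (int n))" for t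
    proof (cases "k \<ge> 0")
      case False
      have "\<Lambda> (- k) = - \<Lambda> k" "\<And>t. \<phi> (- t) = \<phi> t" using \<Lambda> \<phi> by (simp_all add: exponent_seq_def Phi_set_def)
      then show ?thesis using False by (metis abs_of_neg linorder_not_le minus_divide_left mult_minus_left)
    qed simp
    moreover have "I_const \<Lambda> n \<phi> \<tau> v \<le> RS_integral (\<lambda>t. \<phi> (\<Lambda> (int (nat \<bar>k\<bar>)) * t / \<Lambda> (int n))) v 0 \<tau>"
      using F(2)[OF that] \<tau> by (intro I_const_lower[OF \<phi> _ mono]) auto
    ultimately show ?thesis by simp
  qed
  have "I_const \<Lambda> n \<phi> \<tau> v * (\<Sum>k\<in>F. c k)
      \<le> (\<Sum>k\<in>F. c k * RS_integral (\<lambda>t. \<phi> (\<Lambda> k * t / \<Lambda> (int n))) v 0 \<tau>)"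
    unfolding sum_distrib_left
    by (intro sum_mono, subst mult.commute, intro mult_left_mono I_le c)
  also have "\<dots> = RS_integral (\<lambda>t. \<Sum>k\<in>F. c k * \<phi> (\<Lambda> k * t / \<Lambda> (int n))) v 0 \<tau>"
    using \<tau> by (intro RS_integral_sum[symmetric] mono continuous_on_dilated_Phi \<phi>) simp
  also have "\<dots> \<le> RS_integral (\<lambda>t. w) v 0 \<tau>"
    using \<tau> w by (intro RS_integral_mono mono continuous_on_sum continuous_on_mult continuous_on_const
        continuous_on_dilated_Phi \<phi>) auto
  also have "\<dots> = w * (v \<tau> - v 0)" using \<tau> by (intro RS_integral_const mono) simp
  finally show ?thesis .
qed

text \<open>The partial sum over the frequencies of modulus below \<open>\<Lambda> n\<close>, which serves as approximant: subtracting it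
  deletes these coefficients and leaves the others alone.\<close>

lemma fourier_coeff_remainder:
  assumes \<Lambda>: "exponent_seq \<Lambda>" and f: "B_ap f" and n: "n \<ge> 1"
  obtains g where "B_ap_on \<Lambda> g" "fourier_exponents g \<subseteq> {- \<Lambda> (int n)<..<\<Lambda> (int n)}"
    "\<And>k. fourier_coeff (\<lambda>x. f x - g x) (\<Lambda> k) = (if \<bar>k\<bar> < int n then 0 else fourier_coeff f (\<Lambda> k))"
proof -
  define F where "F = {- int n<..<int n}"
  define g where "g = (\<lambda>x. \<Sum>k\<in>F. fourier_coeff f (\<Lambda> k) * cis (\<Lambda> k * x))"
  have F: "finite F" by (simp add: F_def)
  have sm: "strict_mono \<Lambda>" by (rule exponent_seq_strict_mono[OF \<Lambda>])
  then have inj: "inj \<Lambda>" by (rule strict_mono_imp_inj_on)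
  have coeff: "fourier_coeff g \<mu> = (\<Sum>k\<in>F. if \<Lambda> k = \<mu> then fourier_coeff f (\<Lambda> k) else 0)" for \<mu>
    unfolding g_def by (rule fourier_coeff_trig_sum[OF F])
  have g: "B_ap g" unfolding g_def using inj by (intro B_ap_trig_sum F) (auto intro: inj_on_subset)
  have exps: "fourier_exponents g \<subseteq> \<Lambda> ` F"
  proof
    fix \<mu> assume "\<mu> \<in> fourier_exponents g"
    then have nz: "(\<Sum>k\<in>F. if \<Lambda> k = \<mu> then fourier_coeff f (\<Lambda> k) else 0) \<noteq> 0"
      by (simp add: fourier_exponents_def coeff)
    show "\<mu> \<in> \<Lambda> ` F"
    proof (rule ccontr)
      assume "\<mu> \<notin> \<Lambda> ` F"
      then have "(\<Sum>k\<in>F. if \<Lambda> k = \<mu> then fourier_coeff f (\<Lambda> k) else 0) = 0"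
        by (intro sum.neutral) auto
      then show False using nz by contradiction
    qed
  qed
  show ?thesis
  proof (rule that)
    show "B_ap_on \<Lambda> g" using g exps by (auto simp: B_ap_on_def)
    have "\<Lambda> k \<in> {- \<Lambda> (int n)<..<\<Lambda> (int n)}" if "k \<in> F" for k
    proof -
      have "\<Lambda> (- int n) = - \<Lambda> (int n)" using \<Lambda> by (simp add: exponent_seq_def)
      then show ?thesis using that strict_monoD[OF sm, of "- int n" k] strict_monoD[OF sm, of k "int n"]
        by (auto simp: F_def)
    qed
    then show "fourier_exponents g \<subseteq> {- \<Lambda> (int n)<..<\<Lambda> (int n)}" using exps by blast
    fix k
    have "fourier_coeff g (\<Lambda> k) = (\<Sum>j\<in>F. if j = k then fourier_coeff f (\<Lambda> k) else 0)"
      unfolding coeff by (intro sum.cong) (auto simp: inj_eq[OF inj])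
    also have "\<dots> = (if \<bar>k\<bar> < int n then fourier_coeff f (\<Lambda> k) else 0)"
      using F by (auto simp: F_def)
    finally show "fourier_coeff (\<lambda>x. f x - g x) (\<Lambda> k) = (if \<bar>k\<bar> < int n then 0 else fourier_coeff f (\<Lambda> k))"
      unfolding fourier_coeff_diff[OF f g] by simp
  qed
qed

text \<open>The error of the partial sum is the norm of the tail, and sums of nonnegative extended reals are
  suprema of finite sums.\<close>

lemma best_approx_le_if_tails_le:
  assumes \<Lambda>: "exponent_seq \<Lambda>" and f: "B_ap f" and n: "n \<ge> 1"
    and tail: "\<And>\<gamma> F. \<gamma> \<in> Gamma_set M \<Longrightarrow> finite F \<Longrightarrow> (\<And>k. k \<in> F \<Longrightarrow> int n \<le> \<bar>k\<bar>) \<Longrightarrow>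
      ereal (\<Sum>k\<in>F. \<gamma> k * cmod (fourier_coeff f (\<Lambda> k))) \<le> B"
  shows "best_approx M \<Lambda> (\<Lambda> (int n)) f \<le> B"
proof -
  obtain g where g: "B_ap_on \<Lambda> g" "fourier_exponents g \<subseteq> {- \<Lambda> (int n)<..<\<Lambda> (int n)}"
    and coeff: "\<And>k. fourier_coeff (\<lambda>x. f x - g x) (\<Lambda> k) = (if \<bar>k\<bar> < int n then 0 else fourier_coeff f (\<Lambda> k))"
    using fourier_coeff_remainder[OF \<Lambda> f n] by blast
  have "best_approx M \<Lambda> (\<Lambda> (int n)) f \<le> BS_norm M \<Lambda> (\<lambda>x. f x - g x)"
    unfolding best_approx_def using g by (intro INF_lower) simp
  also have "\<dots> \<le> B" unfolding BS_norm_def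
  proof (rule SUP_least, rule ereal_infsum_le)
    fix \<gamma> :: "int \<Rightarrow> real" and F :: "int set" assume \<gamma>: "\<gamma> \<in> Gamma_set M" and F: "finite F"
    have "(\<Sum>k\<in>F. ereal (\<gamma> k * cmod (fourier_coeff (\<lambda>x. f x - g x) (\<Lambda> k))))
        = ereal (\<Sum>k\<in>F. \<gamma> k * cmod (fourier_coeff (\<lambda>x. f x - g x) (\<Lambda> k)))"
      by (rule sum_ereal)
    also have "(\<Sum>k\<in>F. \<gamma> k * cmod (fourier_coeff (\<lambda>x. f x - g x) (\<Lambda> k)))
        = (\<Sum>k\<in>{k\<in>F. int n \<le> \<bar>k\<bar>}. \<gamma> k * cmod (fourier_coeff f (\<Lambda> k)))"
      using F by (intro sum.mono_neutral_cong_right) (auto simp: coeff)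
    also have "ereal \<dots> \<le> B" by (rule tail[OF \<gamma>]) (use F in auto)
    finally show "(\<Sum>k\<in>F. ereal (\<gamma> k * cmod (fourier_coeff (\<lambda>x. f x - g x) (\<Lambda> k)))) \<le> B" .
  qed (auto simp: Gamma_set_def less_imp_le)
  finally show ?thesis .
qed

theorem theorem3p1:
  fixes \<Lambda> :: "int \<Rightarrow> real" and M :: "int \<Rightarrow> real \<Rightarrow> real" and f :: "real \<Rightarrow> complex"
    and \<tau> :: real and n :: nat and \<phi> :: "real \<Rightarrow> real"
  assumes "exponent_seq \<Lambda>"
    and "\<And>k. orlicz_fun (M k)"
    and "f \<in> BS_space M \<Lambda>"
    and "form_F \<Lambda> f"
    and "\<tau> > 0"
    and "n \<ge> 1"
    and "\<phi> \<in> Phi_set"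
  shows "best_approx M \<Lambda> (\<Lambda> (int n)) f
           \<le> K_const \<Lambda> n \<phi> \<tau> * gen_modulus M \<Lambda> \<phi> f (\<tau> / \<Lambda> (int n))
         \<and> (\<exists>v\<^sub>0\<in>V_set \<tau>. V_ratio \<Lambda> n \<phi> \<tau> v\<^sub>0 = K_const \<Lambda> n \<phi> \<tau>)"
proof
  show "\<exists>v\<^sub>0\<in>V_set \<tau>. V_ratio \<Lambda> n \<phi> \<tau> v\<^sub>0 = K_const \<Lambda> n \<phi> \<tau>"
    by (rule extremal_weight_exists[OF assms(7,5)])
  then obtain v where v: "v \<in> V_set \<tau>" and K: "V_ratio \<Lambda> n \<phi> \<tau> v = K_const \<Lambda> n \<phi> \<tau>" by blast
  define I where "I = I_const \<Lambda> n \<phi> \<tau> v"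
  define c where "c = v \<tau> - v 0"
  define \<omega> where "\<omega> = gen_modulus M \<Lambda> \<phi> f (\<tau> / \<Lambda> (int n))"
  have c: "c > 0" using V_set_increment_pos[OF v assms(5)] by (simp add: c_def)
  have I: "I \<ge> 0" unfolding I_def using v assms by (intro I_const_nonneg) (auto simp: V_set_def)
  have \<Lambda>n: "\<Lambda> (int n) > 0" using assms(1,6) by (simp add: exponent_seq_def)
  have \<omega>: "\<omega> > 0" unfolding \<omega>_def
    using \<Lambda>n assms by (intro gen_modulus_pos) auto
  show "best_approx M \<Lambda> (\<Lambda> (int n)) f \<le> K_const \<Lambda> n \<phi> \<tau> * gen_modulus M \<Lambda> \<phi> f (\<tau> / \<Lambda> (int n))"
  proof (cases "I = 0 \<or> \<omega> = \<infinity>")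
    case True
    \<comment> \<open>In either case both factors are positive and one of them is infinite.\<close>
    have "K_const \<Lambda> n \<phi> \<tau> > 0" "I = 0 \<Longrightarrow> K_const \<Lambda> n \<phi> \<tau> = \<infinity>"
      using c I unfolding K[symmetric] V_ratio_eq[OF V_set_increment_pos[OF v assms(5)]] I_def[symmetric] c_def[symmetric]
      by auto
    then have "K_const \<Lambda> n \<phi> \<tau> * \<omega> = \<infinity>" using True \<omega> by auto
    then show ?thesis unfolding \<omega>_def by (simp only: ereal_less_eq(1))
  next
    case False
    then obtain w where w: "\<omega> = ereal w" using \<omega> by (cases \<omega>) auto
    have Ipos: "I > 0" using False I by simp
    have "best_approx M \<Lambda> (\<Lambda> (int n)) f \<le> ereal (c / I * w)"
    proof (rule best_approx_le_if_tails_le[OF assms(1) _ assms(6)])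
      show "B_ap f" using assms(3) by (simp add: BS_space_def B_ap_on_def)
      fix \<gamma> :: "int \<Rightarrow> real" and F :: "int set"
      assume \<gamma>: "\<gamma> \<in> Gamma_set M" and F: "finite F" "\<And>k. k \<in> F \<Longrightarrow> int n \<le> \<bar>k\<bar>"
      have "I * (\<Sum>k\<in>F. \<gamma> k * cmod (fourier_coeff f (\<Lambda> k))) \<le> w * c" unfolding I_def c_def
      proof (rule I_const_times_tail_le[OF assms(1,7,5) v F])
        fix t assume t: "0 \<le> t" "t \<le> \<tau>"
        have "\<bar>t / \<Lambda> (int n)\<bar> \<le> \<tau> / \<Lambda> (int n)" using t \<Lambda>n by (simp add: divide_right_mono)
        from gen_modulus_upper[OF assms(7) this \<gamma> F(1), of \<Lambda> f]
        show "(\<Sum>k\<in>F. \<gamma> k * cmod (fourier_coeff f (\<Lambda> k)) * \<phi> (\<Lambda> k * t / \<Lambda> (int n))) \<le> w"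
          using w unfolding \<omega>_def by (simp add: mult_ac)
      qed (use \<gamma> in \<open>auto simp: Gamma_set_def less_imp_le\<close>)
      then show "ereal (\<Sum>k\<in>F. \<gamma> k * cmod (fourier_coeff f (\<Lambda> k))) \<le> ereal (c / I * w)"
        using Ipos by (simp add: field_simps)
    qed
    also have "\<dots> = K_const \<Lambda> n \<phi> \<tau> * \<omega>"
      using Ipos unfolding K[symmetric] V_ratio_eq[OF V_set_increment_pos[OF v assms(5)]] I_def[symmetric] c_def[symmetric] w
      by simp
    finally show ?thesis unfolding \<omega>_def .
  qed
qed

end
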